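(* Every $\varepsilon$-test for the property of being a product distribution over $\{0,1\}^n$, in the subcube conditional query model, must make at least $\Omega(\sqrt{n}/\varepsilon^2)$ subcube queries.
   Context: A distribution $\mu$ over $\{0,1\}^n$ is a product distribution if there are distributions $\mu_1,\dots,\mu_n$ over $\{0,1\}$ with $\mu=\mu_1\times\cdots\times\mu_n$. The subcube oracle to $\mu$ takes as input a set $I\subseteq[n]$ and a string $w\in\{0,1\}^I$, and returns an independent sample $x\sim\mu$ conditioned on $x_I=w$ (error if this event has probability $0$). An $\varepsilon$-test for a property $\mathcal P$ (a set of distributions) is an algorithm that accepts with probability at least $2/3$ every input distribution in $\mathcal P$, and rejects with probability at least $2/3$ every input distribution $\mu$ with $d_{TV}(\mu,\nu)>\varepsilon$ for all $\nu\in\mathcal P$, where $d_{TV}$ is total variation distance. *)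

theory Defs
  imports "HOL-Probability.Probability" "HOL-Probability.Product_PMF"
begin

text \<open>
  A string in \<open>{0,1}\<^sup>n\<close> is a function \<^typ>\<open>nat \<Rightarrow> bool\<close> that is \<^const>\<open>False\<close> outside \<open>{..<n}\<close>;
  this is the convention of \<^const>\<open>Pi_pmf\<close> with default value \<^const>\<open>False\<close>.
\<close>

definition cube :: "nat \<Rightarrow> (nat \<Rightarrow> bool) set" where
  "cube n = PiE_dflt {..<n} False (\<lambda>_. UNIV)"

definition cube_dists :: "nat \<Rightarrow> (nat \<Rightarrow> bool) pmf set" where
  "cube_dists n = {\<mu>. set_pmf \<mu> \<subseteq> cube n}"

definition product_dists :: "nat \<Rightarrow> (nat \<Rightarrow> bool) pmf set" where
  "product_dists n = {\<mu>. \<exists>\<nu> :: nat \<Rightarrow> bool pmf. \<mu> = Pi_pmf {..<n} False \<nu>}"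

definition tv_dist :: "'a pmf \<Rightarrow> 'a pmf \<Rightarrow> real" where
  "tv_dist p q = (SUP E. \<bar>measure_pmf.prob p E - measure_pmf.prob q E\<bar>)"

text \<open>Only the values of \<open>w\<close> on \<open>I\<close> matter, so \<open>w\<close> stands for an element of \<open>{0,1}\<^sup>I\<close>.\<close>

definition subcube :: "nat set \<Rightarrow> (nat \<Rightarrow> bool) \<Rightarrow> (nat \<Rightarrow> bool) set" where
  "subcube I w = {x. \<forall>i\<in>I. x i = w i}"

text \<open>The answer \<^const>\<open>None\<close> is the error reported when the conditioning event has probability 0.\<close>

definition subcube_oracle ::
    "(nat \<Rightarrow> bool) pmf \<Rightarrow> nat set \<Rightarrow> (nat \<Rightarrow> bool) \<Rightarrow> (nat \<Rightarrow> bool) option pmf" where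
  "subcube_oracle \<mu> I w =
     (if measure_pmf.prob \<mu> (subcube I w) = 0 then return_pmf None
      else map_pmf Some (cond_pmf \<mu> (subcube I w)))"

text \<open>
  Adaptive randomized algorithms as decision trees: \<open>Coin\<close> draws the rest of the computation from
  a discrete distribution (internal randomness); \<open>Query I w k\<close> asks the oracle and continues with
  \<open>k\<close> applied to the answer. The output \<^const>\<open>True\<close> means ``accept''.
\<close>

datatype algorithm =
    Output bool
  | Coin "algorithm pmf"
  | Query "nat set" "nat \<Rightarrow> bool" "(nat \<Rightarrow> bool) option \<Rightarrow> algorithm"

inductive subcube_algorithm :: "nat \<Rightarrow> algorithm \<Rightarrow> bool" for n where
  "subcube_algorithm n (Output b)"
| "(\<And>A. A \<in> set_pmf p \<Longrightarrow> subcube_algorithm n A) \<Longrightarrow> subcube_algorithm n (Coin p)"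
| "I \<subseteq> {..<n} \<Longrightarrow> (\<And>r. subcube_algorithm n (k r)) \<Longrightarrow> subcube_algorithm n (Query I w k)"

text \<open>Joint distribution of the output and of the number of queries made on input \<open>\<mu>\<close>.\<close>

primrec run :: "(nat \<Rightarrow> bool) pmf \<Rightarrow> algorithm \<Rightarrow> (bool \<times> nat) pmf" where
  "run \<mu> (Output b) = return_pmf (b, 0)"
| "run \<mu> (Coin p) = join_pmf (map_pmf (run \<mu>) p)"
| "run \<mu> (Query I w k) =
     bind_pmf (subcube_oracle \<mu> I w) (\<lambda>r. map_pmf (apsnd Suc) (run \<mu> (k r)))"

definition makes_at_most :: "nat \<Rightarrow> algorithm \<Rightarrow> nat \<Rightarrow> bool" where
  "makes_at_most n A q \<longleftrightarrow> (\<forall>\<mu>\<in>cube_dists n. \<forall>(b, k)\<in>set_pmf (run \<mu> A). k \<le> q)"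

definition eps_test :: "nat \<Rightarrow> real \<Rightarrow> (nat \<Rightarrow> bool) pmf set \<Rightarrow> algorithm \<Rightarrow> bool" where
  "eps_test n \<epsilon> P A \<longleftrightarrow> subcube_algorithm n A \<and>
     (\<forall>\<mu>\<in>cube_dists n.
        (\<mu> \<in> P \<longrightarrow> measure_pmf.prob (run \<mu> A) {(b, k). b} \<ge> 2 / 3) \<and>
        ((\<forall>\<nu>\<in>P. tv_dist \<mu> \<nu> > \<epsilon>) \<longrightarrow> measure_pmf.prob (run \<mu> A) {(b, k). \<not> b} \<ge> 2 / 3))"

end

theory Submission
  imports Defs
begin

text \<open>
  Split the coordinates into \<open>m = n div 2\<close> pairs. The hard instances make the pairs independent, each
  bit uniform, and the two bits of pair \<open>i\<close> equal with probability \<open>(1 + \<beta> i) / 2\<close>, where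
  \<open>\<beta> i = \<plusminus>\<delta>\<close> with \<open>\<delta> = \<kappa> / sqrt m\<close> and \<open>\<kappa>\<close> of order \<open>\<epsilon>\<close>; for \<open>\<beta> = 0\<close> this is uniform.

  However a subcube query restricts a pair, its answer can be generated from one independent bit with
  bias \<open>\<beta> i\<close> and fair coins. So \<open>q\<close> adaptive queries reveal no more than \<open>q\<close> independent samples
  from a product of biased bits, and the second moment of the likelihood ratio, averaged over the
  signs, is at most \<open>exp (m * (q * \<delta>\<^sup>2)\<^sup>2)\<close>: a distinguisher needs \<open>q\<close> of order \<open>sqrt m / \<kappa>\<^sup>2\<close>.

  For the distance to product distributions, the Bhattacharyya coefficient is multiplicative over the
  pairs, which gives \<open>1 - exp (- \<kappa>\<^sup>2 / 8)\<close> and settles constant \<open>\<epsilon>\<close>. For small \<open>\<epsilon>\<close> a bound linear in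
  \<open>\<kappa>\<close> comes from the complex test function \<open>\<Prod>i. 1 + \<i> \<eta> s\<^sub>i t\<^sub>i\<close> with \<open>\<eta> = \<plusminus>1 / sqrt m\<close>, of constant
  modulus, whose expectation is explicit under every distribution with independent pairs.
\<close>

subsection \<open>Total variation distance\<close>

lemma prob_diff_le_tv_dist:
  "\<bar>measure_pmf.prob p E - measure_pmf.prob q E\<bar> \<le> tv_dist p q"
proof -
  have "\<bar>measure_pmf.prob p E' - measure_pmf.prob q E'\<bar> \<le> 1" for E'
    using measure_pmf.prob_le_1[of p E'] measure_pmf.prob_le_1[of q E']
      measure_nonneg[of p E'] measure_nonneg[of q E'] by linarith
  then show ?thesis
    unfolding tv_dist_def by (intro cSUP_upper bdd_aboveI2[where M = 1]) auto
qed

lemma tv_dist_map_pmf_le: "tv_dist (map_pmf h p) (map_pmf h q) \<le> tv_dist p q"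
  unfolding tv_dist_def[of "map_pmf h p"]
  by (rule cSUP_least) (auto simp: prob_diff_le_tv_dist)

text \<open>Splitting \<open>X\<close> by the sign of \<open>pmf p x - pmf q x\<close> turns each
  half of the sum into the probability difference of a single event.\<close>

lemma sum_abs_pmf_diff_le_tv_dist:
  assumes "finite X"
  shows "(\<Sum>x\<in>X. \<bar>pmf p x - pmf q x\<bar>) \<le> 2 * tv_dist p q"
proof -
  define E where "E = {x\<in>X. pmf q x \<le> pmf p x}"
  have E: "E \<subseteq> X" "finite E" "finite (X - E)"
    using assms by (auto simp: E_def)
  have "(\<Sum>x\<in>X. \<bar>pmf p x - pmf q x\<bar>)
      = (\<Sum>x\<in>E. \<bar>pmf p x - pmf q x\<bar>) + (\<Sum>x\<in>X - E. \<bar>pmf p x - pmf q x\<bar>)"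
    using sum.subset_diff[OF E(1) assms] by (simp add: add.commute)
  also have "(\<Sum>x\<in>E. \<bar>pmf p x - pmf q x\<bar>) = (\<Sum>x\<in>E. pmf p x - pmf q x)"
    by (intro sum.cong) (auto simp: E_def)
  also have "(\<Sum>x\<in>X - E. \<bar>pmf p x - pmf q x\<bar>) = (\<Sum>x\<in>X - E. pmf q x - pmf p x)"
    by (intro sum.cong) (auto simp: E_def)
  finally show ?thesis
    using prob_diff_le_tv_dist[of p E q] prob_diff_le_tv_dist[of p "X - E" q] E
    by (simp add: measure_measure_pmf_finite sum_subtractf)
qed

text \<open>The event \<open>E\<close> bounds the left side by the sum of the pointwise minima of
  the two mass functions, and a minimum is at most the geometric mean.\<close>

lemma one_minus_tv_dist_le_bhattacharyya:
  assumes "finite X" "set_pmf p \<subseteq> X"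
  shows "1 - tv_dist p q \<le> (\<Sum>x\<in>X. sqrt (pmf p x * pmf q x))"
proof -
  define E where "E = {x\<in>X. pmf q x \<le> pmf p x}"
  have E: "E \<subseteq> X" "finite E"
    using assms by (auto simp: E_def)
  have sqrt_ge: "a \<le> sqrt (a * b)" if "0 \<le> a" "a \<le> b" for a b :: real
    using that by (intro real_le_rsqrt) (auto simp: power2_eq_square intro: mult_left_mono)
  have "1 = (\<Sum>x\<in>X. pmf p x)"
    using sum_pmf_eq_1[OF assms] by simp
  also have "\<dots> = (\<Sum>x\<in>E. pmf p x) + (\<Sum>x\<in>X - E. pmf p x)"
    using sum.subset_diff[OF E(1) assms(1), of "pmf p"] by simp
  finally have "1 - tv_dist p q \<le> (\<Sum>x\<in>E. pmf q x) + (\<Sum>x\<in>X - E. pmf p x)"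
    using prob_diff_le_tv_dist[of p E q] E by (simp add: measure_measure_pmf_finite)
  also have "(\<Sum>x\<in>E. pmf q x) \<le> (\<Sum>x\<in>E. sqrt (pmf p x * pmf q x))"
    using sqrt_ge by (intro sum_mono) (auto simp: E_def mult.commute[of "pmf p _"])
  also have "(\<Sum>x\<in>X - E. pmf p x) \<le> (\<Sum>x\<in>X - E. sqrt (pmf p x * pmf q x))"
    using sqrt_ge by (intro sum_mono) (auto simp: E_def)
  also have "(\<Sum>x\<in>E. sqrt (pmf p x * pmf q x)) + (\<Sum>x\<in>X - E. sqrt (pmf p x * pmf q x))
      = (\<Sum>x\<in>X. sqrt (pmf p x * pmf q x))"
    using sum.subset_diff[OF E(1) assms(1), of "\<lambda>x. sqrt (pmf p x * pmf q x)"] by simp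
  finally show ?thesis by simp
qed

text \<open>A bounded complex test function with different expectations under \<open>p\<close> and
  \<open>q\<close> certifies distance between them.\<close>

lemma norm_expectation_diff_le_tv_dist:
  fixes G :: "'a \<Rightarrow> complex"
  assumes "finite X" and "\<And>x. x \<in> X \<Longrightarrow> norm (G x) \<le> B" "0 \<le> B"
  shows "norm ((\<Sum>x\<in>X. pmf p x *\<^sub>R G x) - (\<Sum>x\<in>X. pmf q x *\<^sub>R G x)) \<le> 2 * B * tv_dist p q"
proof -
  have "(\<Sum>x\<in>X. pmf p x *\<^sub>R G x) - (\<Sum>x\<in>X. pmf q x *\<^sub>R G x)
      = (\<Sum>x\<in>X. (pmf p x - pmf q x) *\<^sub>R G x)"
    by (simp add: sum_subtractf scaleR_left_diff_distrib)
  also have "norm \<dots> \<le> (\<Sum>x\<in>X. \<bar>pmf p x - pmf q x\<bar> * B)"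
    by (intro sum_norm_le) (auto simp: assms mult_left_mono)
  also have "\<dots> = B * (\<Sum>x\<in>X. \<bar>pmf p x - pmf q x\<bar>)"
    by (simp add: sum_distrib_left mult.commute)
  also have "\<dots> \<le> B * (2 * tv_dist p q)"
    by (intro mult_left_mono sum_abs_pmf_diff_le_tv_dist assms)
  finally show ?thesis by (simp add: mult_ac)
qed

subsection \<open>Finite product distributions\<close>

lemma sum_prod_PiE_dflt:
  fixes g :: "'i \<Rightarrow> 'b \<Rightarrow> 'c :: comm_semiring_1"
  assumes "finite A" "\<And>i. i \<in> A \<Longrightarrow> finite (B i)"
  shows "(\<Sum>f\<in>PiE_dflt A d B. \<Prod>i\<in>A. g i (f i)) = (\<Prod>i\<in>A. \<Sum>y\<in>B i. g i y)"
proof -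
  have "(\<Sum>f\<in>PiE_dflt A d B. \<Prod>i\<in>A. g i (f i)) = (\<Sum>f\<in>PiE A B. \<Prod>i\<in>A. g i (f i))"
    by (rule sum.reindex_bij_witness[where i = "\<lambda>h x. if x \<in> A then h x else d"
          and j = "\<lambda>h. restrict h A"]) (auto simp: PiE_dflt_def fun_eq_iff PiE_def extensional_def)
  then show ?thesis
    using prod_sum_PiE[of A B g] assms by simp
qed

text \<open>Independence makes the expectation of a coordinatewise product factor. The scalar form
  admits complex-valued \<open>g\<close>, as the test functions below require.\<close>

lemma sum_pmf_Pi_prod:
  fixes g :: "'i \<Rightarrow> 'b :: finite \<Rightarrow> 'c :: {comm_semiring_1, real_algebra_1}"
  assumes "finite A"
  shows "(\<Sum>f\<in>PiE_dflt A d (\<lambda>_. UNIV). pmf (Pi_pmf A d p) f *\<^sub>R (\<Prod>i\<in>A. g i (f i)))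
       = (\<Prod>i\<in>A. \<Sum>y\<in>UNIV. pmf (p i) y *\<^sub>R g i y)"
proof -
  have "(\<Sum>f\<in>PiE_dflt A d (\<lambda>_. UNIV). pmf (Pi_pmf A d p) f *\<^sub>R (\<Prod>i\<in>A. g i (f i)))
      = (\<Sum>f\<in>PiE_dflt A d (\<lambda>_. UNIV). \<Prod>i\<in>A. of_real (pmf (p i) (f i)) * g i (f i))"
    by (intro sum.cong refl)
       (auto simp: pmf_Pi assms PiE_dflt_def scaleR_conv_of_real prod.distrib)
  also have "\<dots> = (\<Prod>i\<in>A. \<Sum>y\<in>UNIV. of_real (pmf (p i) y) * g i y)"
    using assms by (intro sum_prod_PiE_dflt) auto
  finally show ?thesis by (simp add: scaleR_conv_of_real)
qed

text \<open>Conditioning on a box preserves independence, because the mass of a point and the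
  probability of the box both factor over \<open>A\<close>.\<close>

lemma cond_Pi_pmf:
  assumes A: "finite A" and S: "\<And>i. i \<in> A \<Longrightarrow> set_pmf (P i) \<inter> S i \<noteq> {}"
  shows "cond_pmf (Pi_pmf A d P) (PiE_dflt A d S) = Pi_pmf A d (\<lambda>i. cond_pmf (P i) (S i))"
proof (rule pmf_eqI)
  fix f
  have "set_pmf (Pi_pmf A d P) \<inter> PiE_dflt A d S = PiE_dflt A d (\<lambda>i. set_pmf (P i) \<inter> S i)"
    using A by (auto simp: set_Pi_pmf PiE_dflt_def)
  then have ne: "set_pmf (Pi_pmf A d P) \<inter> PiE_dflt A d S \<noteq> {}"
    using S by (simp add: PiE_dflt_empty_iff)
  show "pmf (cond_pmf (Pi_pmf A d P) (PiE_dflt A d S)) f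
      = pmf (Pi_pmf A d (\<lambda>i. cond_pmf (P i) (S i))) f"
  proof (cases "f \<in> PiE_dflt A d S")
    case True
    then have out: "f i = d" if "i \<notin> A" for i
      using that by (auto simp: PiE_dflt_def)
    from True have "(\<Prod>i\<in>A. pmf (cond_pmf (P i) (S i)) (f i))
        = (\<Prod>i\<in>A. pmf (P i) (f i) / measure_pmf.prob (P i) (S i))"
      using S by (intro prod.cong) (auto simp: pmf_cond PiE_dflt_def)
    then show ?thesis
      using True out A
      by (simp add: pmf_cond[OF ne] pmf_Pi' measure_Pi_pmf_PiE_dflt prod_dividef)
  next
    case False
    then consider "\<exists>i. i \<notin> A \<and> f i \<noteq> d" | i where "i \<in> A" "f i \<notin> S i"
      by (auto simp: PiE_dflt_def)
    then have "pmf (Pi_pmf A d (\<lambda>i. cond_pmf (P i) (S i))) f = 0"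
    proof cases
      case 1
      then show ?thesis using A by (auto simp: pmf_Pi_outside)
    next
      case 2
      then show ?thesis using A S by (auto simp: pmf_Pi pmf_cond)
    qed
    then show ?thesis using False by (simp add: pmf_cond[OF ne])
  qed
qed

subsection \<open>Paired distributions\<close>

definition bit_sign :: "bool \<Rightarrow> real" where
  "bit_sign b = (if b then 1 else -1)"

lemma abs_bit_sign [simp]: "\<bar>bit_sign b\<bar> = 1"
  by (simp add: bit_sign_def)

definition biased_bit :: "real \<Rightarrow> bool pmf" where
  "biased_bit \<beta> = bernoulli_pmf ((1 + \<beta>) / 2)"

lemma pmf_biased_bit:
  assumes "\<bar>\<beta>\<bar> \<le> 1"
  shows "pmf (biased_bit \<beta>) b = (1 + \<beta> * bit_sign b) / 2"
  using assms by (cases b) (auto simp: biased_bit_def bit_sign_def field_simps abs_le_iff)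

text \<open>
  The bit \<open>z\<close> says whether the two bits of the pair agree; it is ignored when both are fixed.
\<close>

fun complete_pair :: "bool option \<Rightarrow> bool option \<Rightarrow> bool \<Rightarrow> (bool \<times> bool) pmf" where
  "complete_pair None None z = map_pmf (\<lambda>s. (s, s = z)) (bernoulli_pmf (1 / 2))"
| "complete_pair (Some a) None z = return_pmf (a, a = z)"
| "complete_pair None (Some b) z = return_pmf (b = z, b)"
| "complete_pair (Some a) (Some b) z = return_pmf (a, b)"

text \<open>For \<beta> in [-1, 1], both bits are uniform and the product of their signs has mean
  \<beta>.\<close>

definition pair_dist :: "real \<Rightarrow> (bool \<times> bool) pmf" where
  "pair_dist \<beta> = bind_pmf (biased_bit \<beta>) (complete_pair None None)"

definition pair_constraint :: "bool option \<Rightarrow> bool option \<Rightarrow> (bool \<times> bool) set" where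
  "pair_constraint u v = {(a, b). u \<in> {None, Some a} \<and> v \<in> {None, Some b}}"

lemma pmf_bind_biased_bit:
  assumes "\<bar>\<beta>\<bar> \<le> 1"
  shows "pmf (bind_pmf (biased_bit \<beta>) K) x
       = (1 + \<beta>) / 2 * pmf (K True) x + (1 - \<beta>) / 2 * pmf (K False) x"
  using assms unfolding pmf_bind biased_bit_def
  by (subst integral_bernoulli_pmf) (auto simp: abs_le_iff field_simps)

lemma pmf_complete_pair_free:
  "pmf (complete_pair None None z) (a, b) = (if (a = b) = z then 1 / 2 else 0)"
proof -
  have *: "inj (\<lambda>s. (s, s = z))" by (auto simp: inj_def)
  show ?thesis
  proof (cases "(a = b) = z")
    case True
    then have "(a, b) = (\<lambda>s. (s, s = z)) a" by auto
    then have "pmf (complete_pair None None z) (a, b) = pmf (bernoulli_pmf (1 / 2)) a"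
      using pmf_map_inj'[OF *, of "bernoulli_pmf (1/2)" a] by simp
    then show ?thesis using True by simp
  next
    case False
    then have "(a, b) \<notin> range (\<lambda>s. (s, s = z))" by auto
    then show ?thesis using False by (auto intro!: pmf_map_outside)
  qed
qed

lemma pmf_pair_dist:
  assumes "\<bar>\<beta>\<bar> \<le> 1"
  shows "pmf (pair_dist \<beta>) (a, b) = (1 + \<beta> * bit_sign a * bit_sign b) / 4"
  using assms unfolding pair_dist_def
  by (simp add: pmf_bind_biased_bit pmf_complete_pair_free bit_sign_def del: complete_pair.simps)

lemma pair_dist_0: "pair_dist 0 = pair_pmf (bernoulli_pmf (1 / 2)) (bernoulli_pmf (1 / 2))"
proof (rule pmf_eqI)
  fix x :: "bool \<times> bool"
  show "pmf (pair_dist 0) x = pmf (pair_pmf (bernoulli_pmf (1 / 2)) (bernoulli_pmf (1 / 2))) x"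
    by (cases x) (simp add: pmf_pair_dist pmf_pair)
qed

lemma set_pmf_pair_dist:
  assumes "\<bar>\<beta>\<bar> < 1"
  shows "set_pmf (pair_dist \<beta>) = UNIV"
  using assms by (auto simp: set_pmf_iff pmf_pair_dist bit_sign_def split: if_splits)

lemma pair_constraint_ne: "pair_constraint u v \<noteq> {}"
  by (cases u; cases v) (auto simp: pair_constraint_def)

lemma UNIV_bool_pair: "(UNIV :: (bool \<times> bool) set) =
    {(False, False), (False, True), (True, False), (True, True)}"
  by auto

text \<open>Agreement of the two bits is independent of either bit alone, so with at most one bit
  fixed it still has bias \<beta>; with both fixed the answer is determined. The strict bound on
  \<beta> gives every pair positive probability, so that all these conditionings are
  defined.\<close>

lemma cond_pair_dist:
  assumes \<beta>: "\<bar>\<beta>\<bar> < 1"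
  shows "cond_pmf (pair_dist \<beta>) (pair_constraint u v)
       = bind_pmf (biased_bit \<beta>) (complete_pair u v)"
proof (rule pmf_eqI)
  fix x :: "bool \<times> bool"
  have ne: "set_pmf (pair_dist \<beta>) \<inter> pair_constraint u v \<noteq> {}"
    using pair_constraint_ne set_pmf_pair_dist[OF \<beta>] by simp
  have \<beta>': "\<bar>\<beta>\<bar> \<le> 1" "1 + \<beta> \<noteq> 0" "1 - \<beta> \<noteq> 0" using \<beta> by auto
  obtain a b where x: "x = (a, b)" by (cases x)
  have prob: "measure_pmf.prob (pair_dist \<beta>) (pair_constraint u v)
      = (\<Sum>y\<in>UNIV. if y \<in> pair_constraint u v then pmf (pair_dist \<beta>) y else 0)"
    by (subst measure_measure_pmf_finite) (auto simp: sum.If_cases)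
  show "pmf (cond_pmf (pair_dist \<beta>) (pair_constraint u v)) x
      = pmf (bind_pmf (biased_bit \<beta>) (complete_pair u v)) x"
    unfolding pmf_cond[OF ne] prob UNIV_bool_pair x
    using \<beta>'
    by (cases u; cases v)
       (auto simp: pmf_bind_biased_bit pmf_complete_pair_free pmf_pair_dist bit_sign_def
         pair_constraint_def indicator_def field_simps simp del: complete_pair.simps(1))
qed

section \<open>Encoding sequences of pairs as bit strings\<close>

definition interleave :: "(nat \<Rightarrow> bool \<times> bool) \<Rightarrow> nat \<Rightarrow> bool" where
  "interleave f j = (if even j then fst (f (j div 2)) else snd (f (j div 2)))"

definition uninterleave :: "(nat \<Rightarrow> bool) \<Rightarrow> nat \<Rightarrow> bool \<times> bool" where
  "uninterleave x i = (x (2 * i), x (2 * i + 1))"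

lemma interleave_uninterleave [simp]: "interleave (uninterleave x) = x"
  by (auto simp: interleave_def uninterleave_def fun_eq_iff)

lemma uninterleave_interleave [simp]: "uninterleave (interleave f) = f"
  by (auto simp: interleave_def uninterleave_def fun_eq_iff)

lemma inj_interleave: "inj interleave"
  by (metis injI uninterleave_interleave)

lemma interleave_default_iff:
  "(\<forall>j. j \<notin> {..<2 * m} \<longrightarrow> interleave f j = False) \<longleftrightarrow> (\<forall>i. i \<notin> {..<m} \<longrightarrow> f i = (False, False))"
proof
  assume *: "\<forall>j. j \<notin> {..<2 * m} \<longrightarrow> interleave f j = False"
  show "\<forall>i. i \<notin> {..<m} \<longrightarrow> f i = (False, False)"
  proof (intro allI impI)
    fix i assume "i \<notin> {..<m}"
    then show "f i = (False, False)"
      using *[rule_format, of "2 * i"] *[rule_format, of "2 * i + 1"]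
      by (cases "f i") (auto simp: interleave_def)
  qed
qed (auto simp: interleave_def)

text \<open>Serves in both directions: it shows that the instance with zero bias is a product
  distribution, and it presents an arbitrary product distribution as independent pairs with
  independent entries.\<close>

lemma Pi_pmf_interleave:
  "Pi_pmf {..<2 * m} False \<nu>
     = map_pmf interleave (Pi_pmf {..<m} (False, False) (\<lambda>i. pair_pmf (\<nu> (2 * i)) (\<nu> (2 * i + 1))))"
proof (rule pmf_eqI)
  fix x
  define f where "f = uninterleave x"
  have x: "x = interleave f" by (simp add: f_def)
  have "(\<Prod>j<2 * m. pmf (\<nu> j) (interleave f j))
      = (\<Prod>i<m. pmf (pair_pmf (\<nu> (2 * i)) (\<nu> (2 * i + 1))) (f i))"
  proof (induction m)
    case (Suc m)
    then show ?case
      by (cases "f m") (simp add: interleave_def pmf_pair)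
  qed simp
  then show "pmf (Pi_pmf {..<2 * m} False \<nu>) x = pmf (map_pmf interleave (Pi_pmf {..<m} (False, False)
      (\<lambda>i. pair_pmf (\<nu> (2 * i)) (\<nu> (2 * i + 1))))) x"
    unfolding x pmf_map_inj'[OF inj_interleave] pmf_Pi[OF finite_lessThan] interleave_default_iff
    by argo
qed

text \<open>All coordinates from \<open>2 * m\<close> on are constantly \<open>False\<close>; for
  odd \<open>n\<close> this takes care of the last one.\<close>

definition paired_dist :: "nat \<Rightarrow> (nat \<Rightarrow> real) \<Rightarrow> (nat \<Rightarrow> bool) pmf" where
  "paired_dist m \<beta> = map_pmf interleave (Pi_pmf {..<m} (False, False) (\<lambda>i. pair_dist (\<beta> i)))"

lemma paired_dist_in_cube_dists:
  assumes "2 * m \<le> n"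
  shows "paired_dist m \<beta> \<in> cube_dists n"
proof -
  have "interleave f \<in> cube n"
    if "f \<in> set_pmf (Pi_pmf {..<m} (False, False) (\<lambda>i. pair_dist (\<beta> i)))" for f
  proof -
    have "f i = (False, False)" if "m \<le> i" for i
      using set_Pi_pmf_subset[of "{..<m}" "(False, False)"] \<open>f \<in> _\<close> that by fastforce
    then show ?thesis
      using assms by (auto simp: cube_def PiE_dflt_def interleave_def)
  qed
  then show ?thesis
    by (auto simp: cube_dists_def paired_dist_def)
qed

lemma paired_dist_0_in_product_dists:
  assumes "2 * m \<le> n"
  shows "paired_dist m (\<lambda>_. 0) \<in> product_dists n"
proof -
  have "paired_dist m (\<lambda>_. 0) = Pi_pmf {..<2 * m} False (\<lambda>j. bernoulli_pmf (1 / 2))"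
    unfolding Pi_pmf_interleave paired_dist_def pair_dist_0 ..
  also have "{..<2 * m} = {j \<in> {..<n}. j < 2 * m}"
    using assms by auto
  \<comment> \<open>The coordinates beyond the pairs get the point mass at \<open>False\<close> as
    their factor.\<close>
  also have "Pi_pmf \<dots> False (\<lambda>j. bernoulli_pmf (1 / 2))
      = Pi_pmf {..<n} False (\<lambda>j. if j < 2 * m then bernoulli_pmf (1 / 2) else return_pmf False)"
    by (rule Pi_pmf_if_set[symmetric]) simp
  finally show ?thesis
    unfolding product_dists_def by blast
qed

subsection \<open>Simulating the subcube oracle\<close>

lemma cond_pmf_cong_set:
  assumes "set_pmf p \<inter> S = set_pmf p \<inter> T" "set_pmf p \<inter> S \<noteq> {}"
  shows "cond_pmf p S = cond_pmf p T"
proof (rule pmf_eqI)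
  fix x
  have T: "set_pmf p \<inter> T \<noteq> {}"
    using assms by metis
  have "measure_pmf.prob p S = measure_pmf.prob p (set_pmf p \<inter> S)"
    using measure_Int_set_pmf[of p S] by (metis Int_commute)
  also have "\<dots> = measure_pmf.prob p T"
    unfolding assms(1) using measure_Int_set_pmf[of p T] by (metis Int_commute)
  finally have prob: "measure_pmf.prob p S = measure_pmf.prob p T" .
  have "x \<in> S \<longleftrightarrow> x \<in> T" if "pmf p x \<noteq> 0"
    using assms(1) that unfolding pmf_eq_0_set_pmf by blast
  then show "pmf (cond_pmf p S) x = pmf (cond_pmf p T) x"
    unfolding pmf_cond[OF assms(2)] pmf_cond[OF T] prob by auto
qed

definition fixed_value :: "nat set \<Rightarrow> (nat \<Rightarrow> bool) \<Rightarrow> nat \<Rightarrow> bool option" where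
  "fixed_value I w j = (if j \<in> I then Some (w j) else None)"

text \<open>The bias does not occur here: given the agreement bits \<open>z\<close>, the answer uses
  only fair coins. The error case is a query that demands \<open>True\<close> on a coordinate beyond
  the pairs.\<close>

definition answer :: "nat \<Rightarrow> nat set \<Rightarrow> (nat \<Rightarrow> bool) \<Rightarrow> (nat \<Rightarrow> bool) \<Rightarrow> (nat \<Rightarrow> bool) option pmf" where
  "answer m I w z =
     (if \<exists>j\<in>I. 2 * m \<le> j \<and> w j then return_pmf None
      else map_pmf (Some \<circ> interleave) (Pi_pmf {..<m} (False, False)
        (\<lambda>i. complete_pair (fixed_value I w (2 * i)) (fixed_value I w (2 * i + 1)) (z i))))"

definition agreement_dist :: "nat \<Rightarrow> (nat \<Rightarrow> real) \<Rightarrow> (nat \<Rightarrow> bool) pmf" where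
  "agreement_dist m \<beta> = Pi_pmf {..<m} False (\<lambda>i. biased_bit (\<beta> i))"

text \<open>In pair coordinates a subcube is a box, up to the positions beyond the pairs; these are
  constantly \<open>False\<close>, so a constraint there holds always or never.\<close>

lemma interleave_in_subcube_iff:
  assumes "f \<in> PiE_dflt {..<m} (False, False) (\<lambda>_. UNIV)"
  shows "interleave f \<in> subcube I w \<longleftrightarrow> (\<forall>j\<in>I. 2 * m \<le> j \<longrightarrow> \<not> w j) \<and>
    (\<forall>i<m. f i \<in> pair_constraint (fixed_value I w (2 * i)) (fixed_value I w (2 * i + 1)))"
    (is "_ \<longleftrightarrow> ?out \<and> ?in")
proof -
  have "interleave f j = w j \<longleftrightarrow> \<not> w j" if "2 * m \<le> j" for j
    using assms that by (auto simp: PiE_dflt_def interleave_def)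
  then have out: "?out \<longleftrightarrow> (\<forall>j\<in>I. 2 * m \<le> j \<longrightarrow> interleave f j = w j)"
    by auto
  have "f i \<in> pair_constraint (fixed_value I w (2 * i)) (fixed_value I w (2 * i + 1)) \<longleftrightarrow>
      (2 * i \<in> I \<longrightarrow> interleave f (2 * i) = w (2 * i)) \<and>
      (2 * i + 1 \<in> I \<longrightarrow> interleave f (2 * i + 1) = w (2 * i + 1))" for i
    by (cases "f i") (auto simp: pair_constraint_def fixed_value_def interleave_def)
  then have "?in \<longleftrightarrow> (\<forall>i<m. (2 * i \<in> I \<longrightarrow> interleave f (2 * i) = w (2 * i)) \<and>
      (2 * i + 1 \<in> I \<longrightarrow> interleave f (2 * i + 1) = w (2 * i + 1)))"
    by simp
  also have "\<dots> \<longleftrightarrow> (\<forall>j\<in>I. j < 2 * m \<longrightarrow> interleave f j = w j)"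
  proof (rule iffI)
    assume *: "\<forall>i<m. (2 * i \<in> I \<longrightarrow> interleave f (2 * i) = w (2 * i)) \<and>
      (2 * i + 1 \<in> I \<longrightarrow> interleave f (2 * i + 1) = w (2 * i + 1))"
    have "interleave f j = w j" if "j \<in> I" "j < 2 * m" for j
      using *[rule_format, of "j div 2"] that by (cases "even j") auto
    then show "\<forall>j\<in>I. j < 2 * m \<longrightarrow> interleave f j = w j"
      by blast
  qed simp
  finally show ?thesis
    unfolding subcube_def out mem_Collect_eq by (meson not_le)
qed

text \<open>The heart of the reduction. The conditioning event is a box, so the pairs stay
  independent; each conditioned pair is generated from its own biased bit, and
  \<open>Pi_pmf_bind\<close> draws all these bits first. Hence one query costs one sample of
  \<open>agreement_dist m \<beta>\<close>.\<close>

lemma subcube_oracle_paired_dist: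
  assumes \<beta>: "\<And>i. i < m \<Longrightarrow> \<bar>\<beta> i\<bar> < 1"
  shows "subcube_oracle (paired_dist m \<beta>) I w = bind_pmf (agreement_dist m \<beta>) (answer m I w)"
proof -
  define P where "P = Pi_pmf {..<m} (False, False) (\<lambda>i. pair_dist (\<beta> i))"
  define S where "S i = pair_constraint (fixed_value I w (2 * i)) (fixed_value I w (2 * i + 1))" for i
  have set_P: "set_pmf P = PiE_dflt {..<m} (False, False) (\<lambda>_. UNIV)"
    using \<beta> by (auto simp: P_def set_Pi_pmf PiE_dflt_def set_pmf_pair_dist)
  have paired: "paired_dist m \<beta> = map_pmf interleave P"
    by (simp add: paired_dist_def P_def)
  have prob: "measure_pmf.prob (paired_dist m \<beta>) (subcube I w) = 0
      \<longleftrightarrow> set_pmf P \<inter> interleave -` subcube I w = {}"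
    by (simp add: paired measure_pmf_zero_iff)
  show ?thesis
  proof (cases "\<exists>j\<in>I. 2 * m \<le> j \<and> w j")
    case True
    then have "set_pmf P \<inter> interleave -` subcube I w = {}"
      unfolding set_P by (auto simp: interleave_in_subcube_iff)
    then show ?thesis
      using True prob by (simp add: subcube_oracle_def answer_def[abs_def])
  next
    case False
    have eq: "set_pmf P \<inter> interleave -` subcube I w = PiE_dflt {..<m} (False, False) S"
    proof (rule set_eqI)
      fix f
      show "f \<in> set_pmf P \<inter> interleave -` subcube I w \<longleftrightarrow> f \<in> PiE_dflt {..<m} (False, False) S"
      proof (cases "f \<in> set_pmf P")
        case True
        then show ?thesis
          using False interleave_in_subcube_iff[of f m I w] unfolding set_P
          by (auto simp: PiE_dflt_def S_def)
      qed (auto simp: set_P PiE_dflt_def)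
    qed
    have ne: "PiE_dflt {..<m} (False, False) S \<noteq> {}"
      by (simp add: S_def pair_constraint_ne)
    have sub: "set_pmf P \<inter> PiE_dflt {..<m} (False, False) S = PiE_dflt {..<m} (False, False) S"
      using eq by blast
    have "cond_pmf P (interleave -` subcube I w) = cond_pmf P (PiE_dflt {..<m} (False, False) S)"
      using eq ne sub by (intro cond_pmf_cong_set) auto
    also have "\<dots> = Pi_pmf {..<m} (False, False) (\<lambda>i. cond_pmf (pair_dist (\<beta> i)) (S i))"
      unfolding P_def using \<beta>
      by (intro cond_Pi_pmf) (auto simp: set_pmf_pair_dist S_def pair_constraint_ne)
    also have "\<dots> = Pi_pmf {..<m} (False, False) (\<lambda>i. bind_pmf (biased_bit (\<beta> i))
        (complete_pair (fixed_value I w (2 * i)) (fixed_value I w (2 * i + 1))))"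
      using \<beta> by (intro Pi_pmf_cong) (auto simp: S_def cond_pair_dist)
    also have "\<dots> = bind_pmf (agreement_dist m \<beta>) (\<lambda>z. Pi_pmf {..<m} (False, False)
        (\<lambda>i. complete_pair (fixed_value I w (2 * i)) (fixed_value I w (2 * i + 1)) (z i)))"
      unfolding agreement_dist_def by (rule Pi_pmf_bind) simp
    finally have cond: "cond_pmf P (interleave -` subcube I w) = \<dots>" .
    have "subcube_oracle (paired_dist m \<beta>) I w
        = map_pmf (Some \<circ> interleave) (cond_pmf P (interleave -` subcube I w))"
      using prob eq ne by (simp add: subcube_oracle_def paired cond_map_pmf pmf.map_comp)
    then show ?thesis
      unfolding cond map_bind_pmf answer_def[abs_def] if_not_P[OF False] .
  qed
qed

text \<open>Each query consumes one sample from the list, which therefore has to be as long as the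
  number of queries. The nested \<open>map_pmf\<close> in the \<open>Coin\<close> case gives the
  recursive call the shape that primitive recursion through \<open>pmf\<close> accepts.\<close>

primrec simulate :: "nat \<Rightarrow> algorithm \<Rightarrow> (nat \<Rightarrow> bool) list \<Rightarrow> bool pmf" where
  "simulate m (Output b) = (\<lambda>zs. return_pmf b)"
| "simulate m (Coin p) = (\<lambda>zs. join_pmf (map_pmf (\<lambda>g. g zs) (map_pmf (simulate m) p)))"
| "simulate m (Query I w k) =
     (\<lambda>zs. bind_pmf (answer m I w (hd zs)) (\<lambda>r. simulate m (k r) (tl zs)))"

text \<open>Adaptivity gives no advantage over samples drawn in advance: the samples are independent
  of everything the algorithm has seen, so drawing them commutes with its coins and with earlier
  answers. Surplus samples integrate out.\<close>

lemma map_fst_run_paired_dist: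
  assumes \<beta>: "\<And>i. i < m \<Longrightarrow> \<bar>\<beta> i\<bar> < 1"
    and "\<forall>(b, k)\<in>set_pmf (run (paired_dist m \<beta>) A). k \<le> q"
  shows "map_pmf fst (run (paired_dist m \<beta>) A)
       = bind_pmf (replicate_pmf q (agreement_dist m \<beta>)) (simulate m A)"
  using assms(2)
proof (induction A arbitrary: q)
  case (Output b)
  then show ?case by simp
next
  case (Coin p)
  have "map_pmf fst (run (paired_dist m \<beta>) (Coin p))
      = bind_pmf p (\<lambda>A. map_pmf fst (run (paired_dist m \<beta>) A))"
    by (simp add: join_pmf_def bind_map_pmf map_bind_pmf)
  also have "\<dots> = bind_pmf p (\<lambda>A. bind_pmf (replicate_pmf q (agreement_dist m \<beta>)) (simulate m A))"
  proof (rule bind_pmf_cong[OF refl])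
    fix A assume A: "A \<in> set_pmf p"
    show "map_pmf fst (run (paired_dist m \<beta>) A)
        = bind_pmf (replicate_pmf q (agreement_dist m \<beta>)) (simulate m A)"
      using Coin.prems A by (intro Coin.IH) auto
  qed
  also have "\<dots> = bind_pmf (replicate_pmf q (agreement_dist m \<beta>))
      (\<lambda>zs. bind_pmf p (\<lambda>A. simulate m A zs))"
    by (rule bind_commute_pmf)
  finally show ?case
    by (simp add: join_pmf_def bind_map_pmf)
next
  case (Query I w k)
  let ?\<mu> = "paired_dist m \<beta>" and ?D = "agreement_dist m \<beta>"
  \<comment> \<open>Some outcome of positive probability makes at least one query, so the budget
    \<open>q\<close> is a successor.\<close>
  obtain r0 where "r0 \<in> set_pmf (subcube_oracle ?\<mu> I w)"
    using set_pmf_not_empty[of "subcube_oracle ?\<mu> I w"] by blast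
  moreover obtain b0 k0 where "(b0, k0) \<in> set_pmf (run ?\<mu> (k r0))"
    using set_pmf_not_empty[of "run ?\<mu> (k r0)"] by fast
  ultimately have "Suc k0 \<le> q"
    using Query.prems by force
  then obtain q' where q: "q = Suc q'" by (cases q) auto
  have "map_pmf fst (run ?\<mu> (Query I w k))
      = bind_pmf (subcube_oracle ?\<mu> I w) (\<lambda>r. map_pmf fst (run ?\<mu> (k r)))"
    by (simp add: map_bind_pmf pmf.map_comp o_def)
  also have "\<dots> = bind_pmf (subcube_oracle ?\<mu> I w)
      (\<lambda>r. bind_pmf (replicate_pmf q' ?D) (simulate m (k r)))"
  proof (rule bind_pmf_cong[OF refl])
    fix r assume r: "r \<in> set_pmf (subcube_oracle ?\<mu> I w)"
    show "map_pmf fst (run ?\<mu> (k r)) = bind_pmf (replicate_pmf q' ?D) (simulate m (k r))"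
    proof (rule Query.IH)
      show "\<forall>(b, c)\<in>set_pmf (run ?\<mu> (k r)). c \<le> q'"
        using Query.prems r unfolding q by force
    qed simp
  qed
  also have "\<dots> = bind_pmf ?D (\<lambda>z. bind_pmf (answer m I w z)
      (\<lambda>r. bind_pmf (replicate_pmf q' ?D) (simulate m (k r))))"
    using \<beta> by (simp add: subcube_oracle_paired_dist bind_assoc_pmf)
  \<comment> \<open>The remaining samples do not depend on the answer, so the two draws may be
    exchanged.\<close>
  also have "\<dots> = bind_pmf ?D (\<lambda>z. bind_pmf (replicate_pmf q' ?D)
      (\<lambda>zs. bind_pmf (answer m I w z) (\<lambda>r. simulate m (k r) zs)))"
    by (subst bind_commute_pmf) simp
  finally show ?case
    by (simp add: q bind_assoc_pmf bind_return_pmf)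
qed

subsection \<open>The second moment method\<close>

text \<open>Let \<open>K\<close> be the average over \<open>v\<close> of the likelihood ratios
  \<open>M v\<close>. An acceptance gap of 1/3 between \<open>u\<close> and the mixture forces the
  variance of \<open>K\<close> under \<open>u\<close> to be at least 1/9, and \<open>K\<close> has
  mean 1. The right-hand side is the second moment of \<open>K\<close>, expanded and scaled by the
  squared size of \<open>V\<close>.\<close>

lemma second_moment_ge_of_distinguisher:
  fixes M :: "'v \<Rightarrow> 'x \<Rightarrow> real"
  assumes "finite V" "V \<noteq> {}" "finite X"
    and u: "\<And>x. x \<in> X \<Longrightarrow> 0 \<le> u x" "(\<Sum>x\<in>X. u x) = 1"
    and M: "\<And>v. v \<in> V \<Longrightarrow> (\<Sum>x\<in>X. u x * M v x) = 1"
    and a: "\<And>x. x \<in> X \<Longrightarrow> 0 \<le> a x" "\<And>x. x \<in> X \<Longrightarrow> a x \<le> 1"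
    and acc: "2 / 3 \<le> (\<Sum>x\<in>X. u x * a x)"
    and rej: "\<And>v. v \<in> V \<Longrightarrow> (\<Sum>x\<in>X. u x * M v x * a x) \<le> 1 / 3"
  shows "10 / 9 * (real (card V))\<^sup>2 \<le> (\<Sum>v\<in>V. \<Sum>v'\<in>V. \<Sum>x\<in>X. u x * (M v x * M v' x))"
proof -
  define N where "N = real (card V)"
  have N: "0 < N" using assms(1,2) by (simp add: N_def card_gt_0_iff)
  define K where "K x = (\<Sum>v\<in>V. M v x) / N" for x
  have "(\<Sum>x\<in>X. u x * K x * a x) = (\<Sum>v\<in>V. \<Sum>x\<in>X. u x * M v x * a x) / N"
    by (subst sum.swap) (simp add: K_def sum_divide_distrib sum_distrib_left sum_distrib_right)
  also have "\<dots> \<le> (\<Sum>v\<in>V. 1 / 3) / N"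
    using N rej by (intro divide_right_mono sum_mono) auto
  also have "\<dots> = 1 / 3" using N by (simp add: N_def)
  finally have rej': "(\<Sum>x\<in>X. u x * K x * a x) \<le> 1 / 3" .
  have "(\<Sum>x\<in>X. u x * K x) = (\<Sum>v\<in>V. \<Sum>x\<in>X. u x * M v x) / N"
    by (subst sum.swap) (simp add: K_def sum_divide_distrib sum_distrib_left)
  also have "\<dots> = 1" using N M by (simp add: N_def)
  finally have K1: "(\<Sum>x\<in>X. u x * K x) = 1" .
  have *: "u x * a x - u x * K x * a x \<le> u x * (1 / 6 + 3 / 2 * (1 - K x)\<^sup>2)" if "x \<in> X" for x
  proof -
    have "(1 - K x) * a x \<le> \<bar>1 - K x\<bar>"
      using a[OF that] by (metis abs_ge_self abs_ge_zero abs_mult abs_of_nonneg mult_left_le order_trans)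
    \<comment> \<open>A linearised Cauchy-Schwarz inequality, with equality when
      \<open>\<bar>1 - K x\<bar>\<close> is 1/3, the size of the acceptance gap.\<close>
    also have "\<dots> \<le> 1 / 6 + 3 / 2 * (1 - K x)\<^sup>2"
    proof -
      have "0 \<le> (3 * \<bar>1 - K x\<bar> - 1)\<^sup>2" by simp
      also have "\<dots> = 9 * (1 - K x)\<^sup>2 - 6 * \<bar>1 - K x\<bar> + 1"
        by (simp add: power2_diff power_mult_distrib)
      finally show ?thesis by simp
    qed
    finally have "u x * ((1 - K x) * a x) \<le> u x * (1 / 6 + 3 / 2 * (1 - K x)\<^sup>2)"
      using u(1)[OF that] by (rule mult_left_mono)
    then show ?thesis by (simp add: algebra_simps)
  qed
  have "1 / 3 \<le> (\<Sum>x\<in>X. u x * a x - u x * K x * a x)"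
    using acc rej' by (simp add: sum_subtractf)
  also have "\<dots> \<le> (\<Sum>x\<in>X. u x * (1 / 6 + 3 / 2 * (1 - K x)\<^sup>2))"
    using * by (rule sum_mono)
  also have "\<dots> = (\<Sum>x\<in>X. 5 / 3 * u x - 3 * (u x * K x) + 3 / 2 * (u x * (K x)\<^sup>2))"
    by (intro sum.cong) (auto simp: power2_eq_square field_simps)
  also have "\<dots> = 5 / 3 - 3 + 3 / 2 * (\<Sum>x\<in>X. u x * (K x)\<^sup>2)"
    by (simp only: sum.distrib sum_subtractf sum_distrib_left[symmetric] u(2) K1)
  finally have "10 / 9 \<le> (\<Sum>x\<in>X. u x * (K x)\<^sup>2)" by simp
  also have "\<dots> = (\<Sum>x\<in>X. u x * ((\<Sum>v\<in>V. M v x) * (\<Sum>v'\<in>V. M v' x))) / N\<^sup>2"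
    unfolding sum_divide_distrib[of _ X] by (simp add: K_def power2_eq_square)
  also have "\<dots> = (\<Sum>x\<in>X. \<Sum>v\<in>V. \<Sum>v'\<in>V. u x * (M v x * M v' x)) / N\<^sup>2"
    unfolding sum_product by (simp only: sum_distrib_left)
  also have "(\<Sum>x\<in>X. \<Sum>v\<in>V. \<Sum>v'\<in>V. u x * (M v x * M v' x))
      = (\<Sum>v\<in>V. \<Sum>v'\<in>V. \<Sum>x\<in>X. u x * (M v x * M v' x))"
    by (subst sum.swap) (intro sum.cong refl sum.swap)
  finally show ?thesis
    using N by (simp add: N_def field_simps)
qed

section \<open>Likelihood ratios for lists of independent samples\<close>

lemma sum_prod_list_lists_length:
  fixes f :: "'a \<Rightarrow> 'b :: comm_semiring_1"
  shows "(\<Sum>xs | set xs \<subseteq> C \<and> length xs = q. prod_list (map f xs)) = (\<Sum>x\<in>C. f x) ^ q"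
proof (induction q)
  case 0
  have "{xs. set xs \<subseteq> C \<and> length xs = 0} = {[]}" by auto
  then show ?case by simp
next
  case (Suc q)
  have "inj_on (\<lambda>(xs, n). n # xs) ({xs. set xs \<subseteq> C \<and> length xs = q} \<times> C)"
    by (auto simp: inj_on_def)
  then have "(\<Sum>xs | set xs \<subseteq> C \<and> length xs = Suc q. prod_list (map f xs))
      = (\<Sum>(xs, x)\<in>{xs. set xs \<subseteq> C \<and> length xs = q} \<times> C. f x * prod_list (map f xs))"
    unfolding lists_length_Suc_eq by (subst sum.reindex) (auto intro!: sum.cong)
  also have "\<dots> = (\<Sum>xs | set xs \<subseteq> C \<and> length xs = q. \<Sum>x\<in>C. f x * prod_list (map f xs))"
    by (simp add: sum.cartesian_product)
  also have "\<dots> = (\<Sum>x\<in>C. f x) * (\<Sum>xs | set xs \<subseteq> C \<and> length xs = q. prod_list (map f xs))"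
    by (simp add: sum_distrib_left sum_distrib_right)
  finally show ?case using Suc by simp
qed

lemma pmf_replicate_pmf:
  "pmf (replicate_pmf q p) xs = (if length xs = q then prod_list (map (pmf p) xs) else 0)"
proof (induction q arbitrary: xs)
  case (Suc q)
  have eq: "replicate_pmf (Suc q) p = map_pmf (\<lambda>(x, xs). x # xs) (pair_pmf p (replicate_pmf q p))"
    by (simp add: pair_pmf_def map_bind_pmf)
  have inj: "inj (\<lambda>(x, xs). x # xs)" by (auto simp: inj_def)
  show ?case
  proof (cases xs)
    case Nil
    then have "xs \<notin> set_pmf (replicate_pmf (Suc q) p)" by (simp add: set_replicate_pmf)
    then show ?thesis using Nil unfolding set_pmf_iff by simp
  next
    case (Cons y ys)
    then show ?thesis
      using pmf_map_inj'[OF inj, of "pair_pmf p (replicate_pmf q p)" "(y, ys)"] Suc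
      unfolding eq by (simp add: pmf_pair)
  qed
qed (auto simp: indicator_def)

text \<open>The density of \<open>agreement_dist m \<beta>\<close> with respect to the uniform
  distribution on \<open>cube m\<close>, for biases in [-1, 1].\<close>

definition likelihood :: "nat \<Rightarrow> (nat \<Rightarrow> real) \<Rightarrow> (nat \<Rightarrow> bool) \<Rightarrow> real" where
  "likelihood m \<beta> z = (\<Prod>i<m. 1 + \<beta> i * bit_sign (z i))"

lemma finite_cube [simp]: "finite (cube m)"
  by (auto simp: cube_def)

lemma card_cube: "card (cube m) = 2 ^ m"
  unfolding cube_def by (subst card_PiE_dflt) auto

lemma sum_prod_cube:
  fixes g :: "nat \<Rightarrow> bool \<Rightarrow> 'c :: comm_semiring_1"
  shows "(\<Sum>z\<in>cube m. \<Prod>i<m. g i (z i)) = (\<Prod>i<m. g i True + g i False)"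
  unfolding cube_def by (subst sum_prod_PiE_dflt) (auto simp: UNIV_bool add.commute)

lemma pmf_agreement_dist:
  assumes "\<And>i. i < m \<Longrightarrow> \<bar>\<beta> i\<bar> \<le> 1" "z \<in> cube m"
  shows "pmf (agreement_dist m \<beta>) z = likelihood m \<beta> z / 2 ^ m"
proof -
  have "pmf (agreement_dist m \<beta>) z = (\<Prod>i<m. pmf (biased_bit (\<beta> i)) (z i))"
    unfolding agreement_dist_def using assms(2)
    by (intro pmf_Pi') (auto simp: cube_def PiE_dflt_def)
  also have "\<dots> = (\<Prod>i<m. (1 + \<beta> i * bit_sign (z i)) / 2)"
    using assms(1) by (intro prod.cong) (auto simp: pmf_biased_bit)
  finally show ?thesis by (simp add: likelihood_def prod_dividef)
qed

text \<open>A change of measure to uniform lists of \<open>q\<close> samples: the instance enters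
  only through the likelihood ratio, while the acceptance function is common to all
  instances.\<close>

lemma acceptance_prob_paired_dist:
  assumes \<beta>: "\<And>i. i < m \<Longrightarrow> \<bar>\<beta> i\<bar> < 1"
    and q: "\<forall>(b, k)\<in>set_pmf (run (paired_dist m \<beta>) A). k \<le> q"
  shows "measure_pmf.prob (run (paired_dist m \<beta>) A) {(b, k). b}
       = (\<Sum>zs | set zs \<subseteq> cube m \<and> length zs = q.
            1 / (2 ^ m) ^ q * prod_list (map (likelihood m \<beta>) zs) * pmf (simulate m A zs) True)"
proof -
  let ?D = "agreement_dist m \<beta>" and ?X = "{zs. set zs \<subseteq> cube m \<and> length zs = q}"
  have "fst -` {True} = {(b, k :: nat). b}" by force
  then have "measure_pmf.prob (run (paired_dist m \<beta>) A) {(b, k). b}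
      = pmf (map_pmf fst (run (paired_dist m \<beta>) A)) True"
    unfolding pmf_map by (rule arg_cong[OF sym])
  also have "\<dots> = measure_pmf.expectation (replicate_pmf q ?D) (\<lambda>zs. pmf (simulate m A zs) True)"
    using map_fst_run_paired_dist[OF assms] by (simp add: pmf_bind)
  also have "\<dots> = (\<Sum>zs\<in>?X. pmf (simulate m A zs) True * pmf (replicate_pmf q ?D) zs)"
  proof (rule integral_measure_pmf_real)
    show "finite ?X" by (intro finite_lists_length_eq) simp
    have "set_pmf ?D \<subseteq> cube m"
      using set_Pi_pmf_subset[of "{..<m}" False]
      by (auto simp: agreement_dist_def cube_def PiE_dflt_def)
    then show "zs \<in> ?X" if "zs \<in> set_pmf (replicate_pmf q ?D)" for zs
      using that by (auto simp: set_replicate_pmf lists_eq_set)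
  qed
  also have "\<dots> = (\<Sum>zs\<in>?X.
      1 / (2 ^ m) ^ q * prod_list (map (likelihood m \<beta>) zs) * pmf (simulate m A zs) True)"
  proof (intro sum.cong refl)
    fix zs assume zs: "zs \<in> ?X"
    have "\<bar>\<beta> i\<bar> \<le> 1" if "i < m" for i using \<beta>[OF that] by simp
    then have "prod_list (map (pmf ?D) zs) = prod_list (map (likelihood m \<beta>) zs) / (2 ^ m) ^ length zs"
      using zs[THEN CollectD, THEN conjunct1]
      by (induction zs) (auto simp: pmf_agreement_dist)
    then show "pmf (simulate m A zs) True * pmf (replicate_pmf q ?D) zs
        = 1 / (2 ^ m) ^ q * prod_list (map (likelihood m \<beta>) zs) * pmf (simulate m A zs) True"
      using zs by (simp add: pmf_replicate_pmf)
  qed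
  finally show ?thesis .
qed

lemma sum_likelihood: "(\<Sum>z\<in>cube m. likelihood m \<beta> z) = 2 ^ m"
  unfolding likelihood_def by (subst sum_prod_cube) (simp add: bit_sign_def)

text \<open>Terms linear in a sign cancel when that sign is summed over; only the constant and the
  product of the two biases survive.\<close>

lemma sum_likelihood_mult:
  "(\<Sum>z\<in>cube m. likelihood m \<beta> z * likelihood m \<gamma> z) = 2 ^ m * (\<Prod>i<m. 1 + \<beta> i * \<gamma> i)"
proof -
  have "(\<Sum>z\<in>cube m. likelihood m \<beta> z * likelihood m \<gamma> z)
      = (\<Sum>z\<in>cube m. \<Prod>i<m. (1 + \<beta> i * bit_sign (z i)) * (1 + \<gamma> i * bit_sign (z i)))"
    by (simp add: likelihood_def prod.distrib)
  also have "\<dots> = (\<Prod>i<m. 2 * (1 + \<beta> i * \<gamma> i))"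
    by (subst sum_prod_cube) (simp add: bit_sign_def algebra_simps)
  finally show ?thesis by (simp only: prod.distrib prod_constant card_lessThan)
qed

lemma prod_list_map_mult:
  fixes f g :: "'a \<Rightarrow> 'b :: comm_monoid_mult"
  shows "prod_list (map f xs) * prod_list (map g xs) = prod_list (map (\<lambda>x. f x * g x) xs)"
  by (induction xs) (simp_all add: ac_simps)

text \<open>For fixed \<open>v\<close> and \<open>v'\<close>, independence of the samples yields a
  \<open>q\<close>-th power of a product over the pairs. Regrouped by pairs, it factors under the
  sum over \<open>v'\<close>, and each factor takes both values of the sign product once, whatever
  \<open>v\<close> is.\<close>

lemma second_moment_random_signs:
  "(\<Sum>v\<in>cube m. \<Sum>v'\<in>cube m. \<Sum>zs | set zs \<subseteq> cube m \<and> length zs = q. 1 / (2 ^ m) ^ q *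
      (prod_list (map (likelihood m (\<lambda>i. \<delta> * bit_sign (v i))) zs) *
       prod_list (map (likelihood m (\<lambda>i. \<delta> * bit_sign (v' i))) zs)))
   = (2 ^ m)\<^sup>2 * (((1 + \<delta>\<^sup>2) ^ q + (1 - \<delta>\<^sup>2) ^ q) / 2) ^ m" (is "?lhs = _")
proof -
  have "?lhs = (\<Sum>v\<in>cube m. \<Sum>v'\<in>cube m. \<Prod>i<m. (1 + \<delta>\<^sup>2 * (bit_sign (v i) * bit_sign (v' i))) ^ q)"
  proof (intro sum.cong refl)
    fix v v' assume "v \<in> cube m" "v' \<in> cube m"
    have "(\<Sum>zs | set zs \<subseteq> cube m \<and> length zs = q. 1 / (2 ^ m) ^ q *
        (prod_list (map (likelihood m (\<lambda>i. \<delta> * bit_sign (v i))) zs) *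
         prod_list (map (likelihood m (\<lambda>i. \<delta> * bit_sign (v' i))) zs)))
        = 1 / (2 ^ m) ^ q * (2 ^ m * (\<Prod>i<m. 1 + \<delta> * bit_sign (v i) * (\<delta> * bit_sign (v' i)))) ^ q"
      unfolding prod_list_map_mult sum_distrib_left[symmetric] sum_prod_list_lists_length
        sum_likelihood_mult ..
    then show "(\<Sum>zs | set zs \<subseteq> cube m \<and> length zs = q. 1 / (2 ^ m) ^ q *
        (prod_list (map (likelihood m (\<lambda>i. \<delta> * bit_sign (v i))) zs) *
         prod_list (map (likelihood m (\<lambda>i. \<delta> * bit_sign (v' i))) zs)))
        = (\<Prod>i<m. (1 + \<delta>\<^sup>2 * (bit_sign (v i) * bit_sign (v' i))) ^ q)"
      by (simp add: power_mult_distrib prod_power_distrib power2_eq_square mult_ac)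
  qed
  also have "\<dots> = (\<Sum>v\<in>cube m. \<Prod>i<m. (1 + \<delta>\<^sup>2) ^ q + (1 - \<delta>\<^sup>2) ^ q)"
  proof (intro sum.cong refl)
    fix v
    show "(\<Sum>v'\<in>cube m. \<Prod>i<m. (1 + \<delta>\<^sup>2 * (bit_sign (v i) * bit_sign (v' i))) ^ q)
        = (\<Prod>i<m. (1 + \<delta>\<^sup>2) ^ q + (1 - \<delta>\<^sup>2) ^ q)"
      by (subst sum_prod_cube[where g = "\<lambda>i b. (1 + \<delta>\<^sup>2 * (bit_sign (v i) * bit_sign b)) ^ q"])
         (rule prod.cong[OF refl], simp add: bit_sign_def add.commute)
  qed
  finally show ?thesis
    by (simp add: card_cube power2_eq_square power_divide)
qed

text \<open>With \<open>y = real q * x\<close> the two powers are at most \<open>exp y\<close> and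
  \<open>exp (- y)\<close>. Their quadratic bounds have opposite linear terms, which cancel in the
  average; the surviving square is the source of the square root in the query bound.\<close>

lemma average_power_le_exp:
  fixes x :: real
  assumes "0 \<le> x" "x \<le> 1" "real q * x \<le> 1"
  shows "((1 + x) ^ q + (1 - x) ^ q) / 2 \<le> exp ((real q * x)\<^sup>2)"
proof -
  define y where "y = real q * x"
  have y: "0 \<le> y" "y \<le> 1" using assms by (auto simp: y_def)
  have "(1 + x) ^ q \<le> exp x ^ q"
    using assms by (intro power_mono) auto
  also have "\<dots> = exp y" by (simp add: y_def exp_of_nat_mult)
  also have "\<dots> \<le> 1 + y + y\<^sup>2" using y by (rule exp_bound)
  finally have 1: "(1 + x) ^ q \<le> 1 + y + y\<^sup>2" .
  have "(1 - x) ^ q \<le> exp (- x) ^ q"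
    using assms exp_ge_add_one_self[of "- x"] by (intro power_mono) auto
  also have "\<dots> = exp (- y)" using exp_of_nat_mult[of q "- x"] by (simp add: y_def)
  also have "\<dots> \<le> 1 / (1 + y)"
    using y by (simp add: exp_minus inverse_eq_divide frac_le)
  also have "\<dots> \<le> 1 - y + y\<^sup>2"
  proof -
    have "(1 - y + y\<^sup>2) * (1 + y) = 1 + y ^ 3"
      by (simp add: algebra_simps power2_eq_square power3_eq_cube)
    then show ?thesis using y by (simp add: divide_le_eq)
  qed
  finally have "((1 + x) ^ q + (1 - x) ^ q) / 2 \<le> 1 + y\<^sup>2" using 1 by simp
  also have "\<dots> \<le> exp (y\<^sup>2)" by simp
  finally show ?thesis by (simp add: y_def)
qed

text \<open>If \<open>real q * \<delta>\<^sup>2\<close> exceeds 1 the claim is immediate. Otherwise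
  the test distinguishes the zero-bias instance from all sign patterns, and the second moment it
  forces is compared with the exponential bound.\<close>

lemma query_lower_bound:
  assumes m: "0 < m" and \<delta>: "0 \<le> \<delta>" "\<delta> < 1" and n: "2 * m \<le> n"
    and q: "makes_at_most n A q"
    and acc: "measure_pmf.prob (run (paired_dist m (\<lambda>_. 0)) A) {(b, k). b} \<ge> 2 / 3"
    and rej: "\<And>v. measure_pmf.prob (run (paired_dist m (\<lambda>i. \<delta> * bit_sign (v i))) A) {(b, k). \<not> b} \<ge> 2 / 3"
  shows "1 / 10 \<le> real m * (real q * \<delta>\<^sup>2)\<^sup>2"
proof (cases "real q * \<delta>\<^sup>2 \<le> 1")
  case False
  then have "1 * 1 \<le> real m * (real q * \<delta>\<^sup>2)\<^sup>2"
    using m by (intro mult_mono) auto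
  then show ?thesis by simp
next
  case True
  let ?X = "{zs. set zs \<subseteq> cube m \<and> length zs = q}"
  let ?M = "\<lambda>v zs. prod_list (map (likelihood m (\<lambda>i. \<delta> * bit_sign (v i))) zs)"
  have count: "\<forall>(b, k)\<in>set_pmf (run (paired_dist m \<beta>) A). k \<le> q" for \<beta>
    using q paired_dist_in_cube_dists[OF n] unfolding makes_at_most_def by blast
  have card_X: "card ?X = (2 ^ m) ^ q"
    using card_lists_length_eq[of "cube m" q] by (simp add: card_cube)
  have "10 / 9 * (real (card (cube m)))\<^sup>2 \<le> (\<Sum>v\<in>cube m. \<Sum>v'\<in>cube m. \<Sum>zs\<in>?X.
      1 / (2 ^ m) ^ q * (?M v zs * ?M v' zs))"
  proof (rule second_moment_ge_of_distinguisher)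
    show "finite ?X" by (intro finite_lists_length_eq) simp
    show "cube m \<noteq> {}" by (simp add: cube_def)
    show "(\<Sum>zs\<in>?X. 1 / (2 ^ m) ^ q) = (1 :: real)"
      by (simp add: card_X)
    show "(\<Sum>zs\<in>?X. 1 / (2 ^ m) ^ q * ?M v zs) = 1" for v
      unfolding sum_distrib_left[symmetric] sum_prod_list_lists_length sum_likelihood by simp
    show "2 / 3 \<le> (\<Sum>zs\<in>?X. 1 / (2 ^ m) ^ q * pmf (simulate m A zs) True)"
    proof -
      have "prod_list (map (likelihood m (\<lambda>_. 0)) zs) = 1" for zs
        by (induction zs) (auto simp: likelihood_def)
      then show ?thesis
        using acc acceptance_prob_paired_dist[of m "\<lambda>_. 0" A q] count by simp
    qed
    show "(\<Sum>zs\<in>?X. 1 / (2 ^ m) ^ q * ?M v zs * pmf (simulate m A zs) True) \<le> 1 / 3" for v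
    proof -
      let ?R = "run (paired_dist m (\<lambda>i. \<delta> * bit_sign (v i))) A"
      have "{(b, k :: nat). \<not> b} = - {(b, k). b}" by auto
      then have "measure_pmf.prob ?R {(b, k). \<not> b} = 1 - measure_pmf.prob ?R {(b, k). b}"
        using measure_pmf.prob_compl[of "{(b, k). b}" ?R]
        by (simp add: Compl_eq_Diff_UNIV)
      then have "measure_pmf.prob ?R {(b, k). b} \<le> 1 / 3"
        using rej[of v] by simp
      moreover have "\<bar>\<delta> * bit_sign (v i)\<bar> < 1" for i
        using \<delta> by (simp add: abs_mult)
      ultimately show ?thesis
        using acceptance_prob_paired_dist[of m "\<lambda>i. \<delta> * bit_sign (v i)" A q] count by simp
    qed
  qed (auto simp: pmf_le_1)
  then have "10 / 9 \<le> (((1 + \<delta>\<^sup>2) ^ q + (1 - \<delta>\<^sup>2) ^ q) / 2) ^ m"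
    unfolding second_moment_random_signs by (simp add: card_cube)
  also have "\<dots> \<le> exp ((real q * \<delta>\<^sup>2)\<^sup>2) ^ m"
    using \<delta> True by (intro power_mono average_power_le_exp) (auto simp: power_le_one intro!: add_nonneg_nonneg)
  also have "\<dots> = exp (real m * (real q * \<delta>\<^sup>2)\<^sup>2)"
    by (simp add: exp_of_nat_mult)
  finally have *: "10 / 9 \<le> exp (real m * (real q * \<delta>\<^sup>2)\<^sup>2)" .
  show ?thesis
  proof (rule ccontr)
    assume "\<not> ?thesis"
    \<comment> \<open>The constant 1/10 works because its exponential is at most 1.11, which is less
      than 10/9.\<close>
    then have "exp (real m * (real q * \<delta>\<^sup>2)\<^sup>2) \<le> exp (1 / 10)" by simp
    also have "\<dots> \<le> 1 + 1 / 10 + (1 / 10)\<^sup>2" by (rule exp_bound) auto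
    finally show False using * by (simp add: power2_eq_square)
  qed
qed

subsection \<open>Distance to product distributions\<close>

text \<open>Resetting the coordinates beyond the pairs and regrouping is a deterministic map, which
  cannot increase distance. It recovers the pairs of the instance and turns \<nu> into independent
  pairs with independent entries.\<close>

lemma tv_dist_paired_dist_product:
  assumes n: "2 * m \<le> n" and "\<nu> \<in> product_dists n"
  obtains a b where "tv_dist (Pi_pmf {..<m} (False, False) (\<lambda>i. pair_dist (\<beta> i)))
      (Pi_pmf {..<m} (False, False) (\<lambda>i. pair_pmf (a i) (b i))) \<le> tv_dist (paired_dist m \<beta>) \<nu>"
proof -
  obtain \<nu>' where \<nu>: "\<nu> = Pi_pmf {..<n} False \<nu>'"
    using assms(2) by (auto simp: product_dists_def)
  define cut :: "(nat \<Rightarrow> bool) \<Rightarrow> nat \<Rightarrow> bool" where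
    "cut x = (\<lambda>j. if j \<in> {..<2 * m} then x j else False)" for x
  define h where "h x = uninterleave (cut x)" for x
  let ?P = "Pi_pmf {..<m} (False, False) (\<lambda>i. pair_dist (\<beta> i))"
  have "h (interleave f) = f" if "f \<in> set_pmf ?P" for f
  proof -
    have "\<forall>i. i \<notin> {..<m} \<longrightarrow> f i = (False, False)"
      using set_Pi_pmf_subset[of "{..<m}" "(False, False)"] that by blast
    then have "cut (interleave f) = interleave f"
      unfolding interleave_default_iff[symmetric] cut_def by auto
    then show ?thesis by (simp add: h_def)
  qed
  then have "map_pmf (\<lambda>f. h (interleave f)) ?P = map_pmf (\<lambda>f. f) ?P"
    by (intro map_pmf_cong) auto
  then have 1: "map_pmf h (paired_dist m \<beta>) = ?P"
    by (simp add: paired_dist_def pmf.map_comp o_def)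
  have "map_pmf h \<nu> = map_pmf uninterleave (map_pmf cut \<nu>)"
    by (simp add: pmf.map_comp o_def h_def[abs_def])
  also have "map_pmf cut \<nu> = Pi_pmf {..<2 * m} False \<nu>'"
    unfolding \<nu> cut_def using n by (intro Pi_pmf_subset[symmetric]) auto
  also have "map_pmf uninterleave \<dots>
      = Pi_pmf {..<m} (False, False) (\<lambda>i. pair_pmf (\<nu>' (2 * i)) (\<nu>' (2 * i + 1)))"
    unfolding Pi_pmf_interleave by (simp add: pmf.map_comp o_def)
  finally have "map_pmf h \<nu> = \<dots>" .
  then show thesis
    using tv_dist_map_pmf_le[of h "paired_dist m \<beta>" \<nu>] that unfolding 1 by metis
qed

lemma pmf_bool_add: "pmf p True + pmf p False = 1"
proof -
  have "(\<Sum>y\<in>UNIV. pmf p y) = 1" by (rule sum_pmf_eq_1) auto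
  then show ?thesis by (simp add: UNIV_bool add.commute)
qed

text \<open>The square roots \<open>A\<close> and \<open>B\<close> of the two marginals are unit
  vectors, so both of their pairings below are at most 1. What remains is the mean of
  \<open>sqrt (1 + \<beta>)\<close> and \<open>sqrt (1 - \<beta>)\<close>, a bound uniform over all
  products.\<close>

lemma bhattacharyya_pair_dist_le:
  assumes "\<bar>\<beta>\<bar> \<le> 1"
  shows "(\<Sum>y\<in>UNIV. sqrt (pmf (pair_dist \<beta>) y * pmf (pair_pmf a b) y)) \<le> exp (- \<beta>\<^sup>2 / 8)"
proof -
  define A where "A s = sqrt (pmf a s)" for s
  define B where "B s = sqrt (pmf b s)" for s
  have A: "(A True)\<^sup>2 + (A False)\<^sup>2 = 1" and B: "(B True)\<^sup>2 + (B False)\<^sup>2 = 1"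
    by (simp_all add: A_def B_def pmf_bool_add)
  have AM_GM: "x * y + z * w \<le> (x\<^sup>2 + y\<^sup>2 + z\<^sup>2 + w\<^sup>2) / 2" for x y z w :: real
    using zero_le_power2[of "x - y"] zero_le_power2[of "z - w"] by (simp add: power2_diff)
  have \<beta>: "0 \<le> 1 + \<beta>" "0 \<le> 1 - \<beta>" using assms by auto
  have "(\<Sum>y\<in>UNIV. sqrt (pmf (pair_dist \<beta>) y * pmf (pair_pmf a b) y))
      = sqrt (1 + \<beta>) / 2 * (A True * B True + A False * B False)
        + sqrt (1 - \<beta>) / 2 * (A True * B False + A False * B True)"
    unfolding UNIV_bool_pair
    by (simp add: pmf_pair_dist assms pmf_pair bit_sign_def real_sqrt_mult real_sqrt_divide A_def B_def)
       (simp add: field_simps)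
  also have "\<dots> \<le> sqrt (1 + \<beta>) / 2 * 1 + sqrt (1 - \<beta>) / 2 * 1"
    using AM_GM[of "A True" "B True" "A False" "B False"] AM_GM[of "A True" "B False" "A False" "B True"]
      A B \<beta> by (intro add_mono mult_left_mono) auto
  also have "\<dots> = (sqrt (1 + \<beta>) + sqrt (1 - \<beta>)) / 2" by (simp add: add_divide_distrib)
  also have "\<dots> \<le> exp (- \<beta>\<^sup>2 / 8)"
  proof (rule power2_le_imp_le)
    have "((sqrt (1 + \<beta>) + sqrt (1 - \<beta>)) / 2)\<^sup>2
        = ((sqrt (1 + \<beta>))\<^sup>2 + (sqrt (1 - \<beta>))\<^sup>2 + 2 * (sqrt (1 + \<beta>) * sqrt (1 - \<beta>))) / 4"
      by (simp add: power2_sum power_divide)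
    also have "\<dots> = (1 + sqrt (1 - \<beta>\<^sup>2)) / 2"
      using \<beta> by (simp add: real_sqrt_mult[symmetric] power2_eq_square algebra_simps)
    also have "sqrt (1 - \<beta>\<^sup>2) \<le> 1 - \<beta>\<^sup>2 / 2"
    proof (rule real_le_lsqrt)
      have "\<beta>\<^sup>2 \<le> 1" using assms by (simp add: abs_square_le_1)
      then show "0 \<le> 1 - \<beta>\<^sup>2 / 2" by simp
      show "1 - \<beta>\<^sup>2 \<le> (1 - \<beta>\<^sup>2 / 2)\<^sup>2" by (simp add: power2_diff)
    qed
    also have "(1 + (1 - \<beta>\<^sup>2 / 2)) / 2 \<le> exp (- \<beta>\<^sup>2 / 4)"
      using exp_ge_add_one_self[of "- \<beta>\<^sup>2 / 4"] by simp
    also have "\<dots> = (exp (- \<beta>\<^sup>2 / 8))\<^sup>2"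
      by (simp add: exp_double[symmetric])
    finally show "((sqrt (1 + \<beta>) + sqrt (1 - \<beta>)) / 2)\<^sup>2 \<le> (exp (- \<beta>\<^sup>2 / 8))\<^sup>2"
      by simp
  qed simp
  finally show ?thesis .
qed

text \<open>The coefficient factors over the pairs, and each of the \<open>m\<close> factors obeys
  the bound for a single pair. The result tends to 1 as \<open>real m * \<delta>\<^sup>2\<close>
  grows, so it reaches every constant below 1.\<close>

lemma paired_dist_far_large:
  assumes \<delta>: "0 \<le> \<delta>" "\<delta> \<le> 1" and n: "2 * m \<le> n" and \<nu>: "\<nu> \<in> product_dists n"
  shows "1 - exp (- (real m * \<delta>\<^sup>2 / 8)) \<le> tv_dist (paired_dist m (\<lambda>i. \<delta> * bit_sign (v i))) \<nu>"
proof -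
  define \<beta> where "\<beta> i = \<delta> * bit_sign (v i)" for i
  have \<beta>: "\<bar>\<beta> i\<bar> \<le> 1" "(\<beta> i)\<^sup>2 = \<delta>\<^sup>2" for i
    using \<delta> by (simp_all add: \<beta>_def abs_mult power2_eq_square bit_sign_def)
  let ?P = "Pi_pmf {..<m} (False, False) (\<lambda>i. pair_dist (\<beta> i))"
  let ?X = "PiE_dflt {..<m} (False, False) (\<lambda>_. UNIV) :: (nat \<Rightarrow> bool \<times> bool) set"
  obtain a b where ab: "tv_dist ?P (Pi_pmf {..<m} (False, False) (\<lambda>i. pair_pmf (a i) (b i)))
      \<le> tv_dist (paired_dist m \<beta>) \<nu>"
    using tv_dist_paired_dist_product[OF n \<nu>] by blast
  let ?Q = "Pi_pmf {..<m} (False, False) (\<lambda>i. pair_pmf (a i) (b i))"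
  have sqrt_prod: "sqrt (\<Prod>i<m. g i) = (\<Prod>i<m. sqrt (g i))" for g
    by (induction m) (simp_all add: real_sqrt_mult)
  have "set_pmf ?P \<subseteq> ?X"
    using set_Pi_pmf_subset'[of "{..<m}" "(False, False)"] by (auto simp: PiE_dflt_def)
  then have "1 - tv_dist ?P ?Q \<le> (\<Sum>f\<in>?X. sqrt (pmf ?P f * pmf ?Q f))"
    by (intro one_minus_tv_dist_le_bhattacharyya) auto
  also have "\<dots> = (\<Sum>f\<in>?X. \<Prod>i<m. sqrt (pmf (pair_dist (\<beta> i)) (f i) * pmf (pair_pmf (a i) (b i)) (f i)))"
    by (intro sum.cong refl)
       (auto simp: pmf_Pi PiE_dflt_def prod.distrib real_sqrt_mult sqrt_prod)
  also have "\<dots> = (\<Prod>i<m. \<Sum>y\<in>UNIV. sqrt (pmf (pair_dist (\<beta> i)) y * pmf (pair_pmf (a i) (b i)) y))"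
    by (rule sum_prod_PiE_dflt) auto
  also have "\<dots> \<le> (\<Prod>i<m. exp (- \<delta>\<^sup>2 / 8))"
    using bhattacharyya_pair_dist_le[OF \<beta>(1)] by (intro prod_mono) (auto simp: \<beta>(2) intro!: sum_nonneg)
  also have "\<dots> = exp (- (real m * \<delta>\<^sup>2 / 8))"
    by (simp add: exp_of_nat_mult[symmetric])
  finally show ?thesis using ab unfolding \<beta>_def by simp
qed

text \<open>Multiplying by \<open>Complex 1 \<tau>\<close> lowers the real part by \<tau> times the
  imaginary part, which is at most 2 since the modulus stays below
  \<open>exp (real k * \<tau>)\<close>. The real part thus remains at least 1/2 in this range, and
  the imaginary part gains at least half of \<tau> per step.\<close>

lemma Im_power_Complex_ge:
  assumes "0 \<le> \<tau>" "real k * \<tau> \<le> 1 / 4"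
  shows "1 - 2 * real k * \<tau> \<le> Re (Complex 1 \<tau> ^ k)" and "real k * \<tau> / 2 \<le> Im (Complex 1 \<tau> ^ k)"
  using assms(2)
proof (induction k)
  case (Suc k)
  {
    case 1
    then have k: "real k * \<tau> \<le> 1 / 4" using assms(1) by (simp add: algebra_simps)
    have "norm (Complex 1 \<tau>) \<le> 1 + \<tau>"
      using norm_triangle_ineq[of 1 "Complex 0 \<tau>"] assms(1)
      by (simp add: complex_eq_iff Complex_eq norm_mult)
    then have "norm (Complex 1 \<tau> ^ k) \<le> exp \<tau> ^ k"
      unfolding norm_power using assms(1) by (intro power_mono order_trans[OF _ exp_ge_add_one_self]) auto
    also have "\<dots> = exp (real k * \<tau>)" by (simp add: exp_of_nat_mult)
    also have "\<dots> \<le> 2"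
      using exp_bound_half[of "real k * \<tau>"] assms(1) k by simp
    finally have "Im (Complex 1 \<tau> ^ k) \<le> 2"
      using abs_Im_le_cmod[of "Complex 1 \<tau> ^ k"] by linarith
    then have "\<tau> * Im (Complex 1 \<tau> ^ k) \<le> \<tau> * 2"
      using assms(1) by (rule mult_left_mono)
    then show ?case
      using Suc.IH(1)[OF k] by (simp add: algebra_simps)
  next
    case 2
    then have k: "real k * \<tau> \<le> 1 / 4" using assms(1) by (simp add: algebra_simps)
    have "1 / 2 \<le> Re (Complex 1 \<tau> ^ k)" using Suc.IH(1)[OF k] k by simp
    then have "\<tau> * (1 / 2) \<le> \<tau> * Re (Complex 1 \<tau> ^ k)"
      using assms(1) by (rule mult_left_mono)
    then show ?case
      using Suc.IH(2)[OF k] by (simp add: algebra_simps)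
  }
qed simp_all

lemma scaleR_sum_Complex_1:
  assumes "(\<Sum>y\<in>Y. p y) = 1"
  shows "(\<Sum>y\<in>Y. p y *\<^sub>R Complex 1 (g y)) = Complex 1 (\<Sum>y\<in>Y. p y * g y)"
  using assms by (simp add: complex_eq_iff)

text \<open>If a product \<open>Q\<close> is close to \<open>P\<close>, its first bits look uniform,
  so its expectation of the test function is close to 1: independence lets the second bits be
  treated as fixed and then averaged. Under \<open>P\<close> the expectation is
  \<open>Complex 1 (\<eta> * \<delta>) ^ m\<close>, whose imaginary part is of order
  \<open>sqrt (real m) * \<delta>\<close>.\<close>

lemma paired_dist_far_small:
  assumes m: "0 < m" and \<delta>: "0 \<le> \<delta>" "\<delta> \<le> 1" and \<kappa>: "sqrt (real m) * \<delta> \<le> 1 / 4"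
    and n: "2 * m \<le> n" and \<nu>: "\<nu> \<in> product_dists n"
  shows "sqrt (real m) * \<delta> / 16 \<le> tv_dist (paired_dist m (\<lambda>i. \<delta> * bit_sign (v i))) \<nu>"
proof -
  define \<beta> where "\<beta> i = \<delta> * bit_sign (v i)" for i
  have \<beta>: "\<bar>\<beta> i\<bar> \<le> 1" for i
    using \<delta> by (simp add: \<beta>_def abs_mult)
  define P where "P = Pi_pmf {..<m} (False, False) (\<lambda>i. pair_dist (\<beta> i))"
  let ?X = "PiE_dflt {..<m} (False, False) (\<lambda>_. UNIV) :: (nat \<Rightarrow> bool \<times> bool) set"
  have X: "finite ?X" by auto
  obtain a b where ab: "tv_dist P (Pi_pmf {..<m} (False, False) (\<lambda>i. pair_pmf (a i) (b i)))
      \<le> tv_dist (paired_dist m \<beta>) \<nu>"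
    using tv_dist_paired_dist_product[OF n \<nu>] unfolding P_def by blast
  define Q where "Q = Pi_pmf {..<m} (False, False) (\<lambda>i. pair_pmf (a i) (b i))"
  define \<alpha> where "\<alpha> i = pmf (a i) True - pmf (a i) False" for i
  define \<gamma> where "\<gamma> i = pmf (b i) True - pmf (b i) False" for i
  define \<eta> where "\<eta> = 1 / sqrt (real m)"
  define B where "B = sqrt (1 + \<eta>\<^sup>2) ^ m"
  \<comment> \<open>The factor \<open>bit_sign (v i)\<close> undoes the signs of the instance, so
    that all pairs contribute alike. The function \<open>w\<close> will be the product of both
    signs, or the first sign times a frozen second one.\<close>
  define G where "G w f = (\<Prod>i<m. Complex 1 (\<eta> * bit_sign (v i) * w i (f i)))"
    for w :: "nat \<Rightarrow> bool \<times> bool \<Rightarrow> real" and f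
  define d where "d = tv_dist P Q"
  have sum_pair: "(\<Sum>y\<in>UNIV. pmf p y) = 1" for p :: "(bool \<times> bool) pmf"
    by (rule sum_pmf_eq_1) auto
  have PG: "(\<Sum>f\<in>?X. pmf P f *\<^sub>R G w f)
      = (\<Prod>i<m. Complex 1 (\<Sum>y\<in>UNIV. pmf (pair_dist (\<beta> i)) y * (\<eta> * bit_sign (v i) * w i y)))" for w
    unfolding P_def G_def
    by (subst sum_pmf_Pi_prod) (simp_all add: scaleR_sum_Complex_1[OF sum_pair])
  have QG: "(\<Sum>f\<in>?X. pmf Q f *\<^sub>R G w f)
      = (\<Prod>i<m. Complex 1 (\<Sum>y\<in>UNIV. pmf (pair_pmf (a i) (b i)) y * (\<eta> * bit_sign (v i) * w i y)))" for w
    unfolding Q_def G_def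
    by (subst sum_pmf_Pi_prod) (simp_all add: scaleR_sum_Complex_1[OF sum_pair])
  have close: "norm ((\<Sum>f\<in>?X. pmf P f *\<^sub>R G w f) - (\<Sum>f\<in>?X. pmf Q f *\<^sub>R G w f)) \<le> 2 * B * d"
    if w: "\<And>i y. \<bar>w i y\<bar> = 1" for w
    unfolding d_def
  proof (rule norm_expectation_diff_le_tv_dist[OF X])
    fix f
    have "(\<eta> * bit_sign (v i) * w i (f i))\<^sup>2 = \<eta>\<^sup>2" for i
      using w[of i "f i"] by (simp add: power_mult_distrib bit_sign_def abs_square_eq_1)
    then have "norm (Complex 1 (\<eta> * bit_sign (v i) * w i (f i))) = sqrt (1 + \<eta>\<^sup>2)" for i
      by (simp add: cmod_def)
    then show "norm (G w f) \<le> B"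
      by (simp add: G_def prod_norm[symmetric] B_def)
  qed (simp add: B_def)

  have 1: "norm (Complex 1 (\<eta> * \<delta>) ^ m - (\<Prod>i<m. Complex 1 (\<eta> * bit_sign (v i) * \<alpha> i * \<gamma> i))) \<le> 2 * B * d"
  proof -
    let ?w = "\<lambda>i (y :: bool \<times> bool). bit_sign (fst y) * bit_sign (snd y)"
    have "(\<Sum>y\<in>UNIV. pmf (pair_dist (\<beta> i)) y * (\<eta> * bit_sign (v i) * ?w i y)) = \<eta> * \<delta>" for i
      unfolding UNIV_bool_pair
      by (simp add: pmf_pair_dist \<beta>) (simp add: \<beta>_def bit_sign_def field_simps)
    moreover have "(\<Sum>y\<in>UNIV. pmf (pair_pmf (a i) (b i)) y * (\<eta> * bit_sign (v i) * ?w i y))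
        = \<eta> * bit_sign (v i) * \<alpha> i * \<gamma> i" for i
      unfolding UNIV_bool_pair
      by (simp add: pmf_pair \<alpha>_def \<gamma>_def) (simp add: bit_sign_def algebra_simps)
    ultimately show ?thesis
      using close[of ?w] unfolding PG QG by (simp add: abs_mult)
  qed
  \<comment> \<open>Freezing the second bits makes the test function blind to \<open>P\<close>, whose first bits are uniform.\<close>
  have 2: "norm (1 - (\<Prod>i<m. Complex 1 (\<eta> * bit_sign (v i) * \<alpha> i * bit_sign (t i)))) \<le> 2 * B * d" for t
  proof -
    let ?w = "\<lambda>i (y :: bool \<times> bool). bit_sign (fst y) * bit_sign (t i)"
    have "(\<Sum>y\<in>UNIV. pmf (pair_dist (\<beta> i)) y * (\<eta> * bit_sign (v i) * ?w i y)) = 0" for i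
      unfolding UNIV_bool_pair
      by (simp add: pmf_pair_dist \<beta>) (simp add: bit_sign_def field_simps)
    moreover have "(\<Sum>y\<in>UNIV. pmf (pair_pmf (a i) (b i)) y * (\<eta> * bit_sign (v i) * ?w i y))
        = \<eta> * bit_sign (v i) * \<alpha> i * bit_sign (t i)" for i
    proof -
      have "(\<Sum>y\<in>UNIV. pmf (pair_pmf (a i) (b i)) y * (\<eta> * bit_sign (v i) * ?w i y))
          = \<eta> * bit_sign (v i) * \<alpha> i * bit_sign (t i) * (pmf (b i) True + pmf (b i) False)"
        unfolding UNIV_bool_pair
        by (simp add: pmf_pair \<alpha>_def) (simp add: bit_sign_def algebra_simps)
      then show ?thesis by (simp add: pmf_bool_add)
    qed
    moreover have "Complex 1 0 = 1" by (simp add: complex_eq_iff)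
    ultimately show ?thesis
      using close[of ?w] unfolding PG QG by (simp add: abs_mult)
  qed
  \<comment> \<open>Fact \<open>2\<close> holds for every \<open>t\<close>; averaging it over second
    bits drawn from the marginals \<open>b i\<close> replaces each frozen sign by its mean
    \<open>\<gamma> i\<close>.\<close>
  have 3: "norm (1 - (\<Prod>i<m. Complex 1 (\<eta> * bit_sign (v i) * \<alpha> i * \<gamma> i))) \<le> 2 * B * d"
  proof -
    let ?T = "PiE_dflt {..<m} False (\<lambda>_. UNIV)" and ?R = "Pi_pmf {..<m} False b"
    let ?H = "\<lambda>t. \<Prod>i<m. Complex 1 (\<eta> * bit_sign (v i) * \<alpha> i * bit_sign (t i))"
    have T1: "(\<Sum>t\<in>?T. pmf ?R t) = 1"
    proof (rule sum_pmf_eq_1)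
      show "set_pmf ?R \<subseteq> ?T"
        using set_Pi_pmf_subset'[of "{..<m}" False b] by (auto simp: PiE_dflt_def)
    qed auto
    have sum_bool: "(\<Sum>y\<in>UNIV. pmf p y) = 1" for p :: "bool pmf"
      by (rule sum_pmf_eq_1) auto
    have "(\<Sum>y\<in>UNIV. pmf (b i) y * (\<eta> * bit_sign (v i) * \<alpha> i * bit_sign y))
        = \<eta> * bit_sign (v i) * \<alpha> i * \<gamma> i" for i
      by (simp add: UNIV_bool \<gamma>_def bit_sign_def algebra_simps)
    then have "(\<Prod>i<m. Complex 1 (\<eta> * bit_sign (v i) * \<alpha> i * \<gamma> i)) = (\<Sum>t\<in>?T. pmf ?R t *\<^sub>R ?H t)"
      by (subst sum_pmf_Pi_prod) (simp_all add: scaleR_sum_Complex_1[OF sum_bool])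
    then have "1 - (\<Prod>i<m. Complex 1 (\<eta> * bit_sign (v i) * \<alpha> i * \<gamma> i))
        = (\<Sum>t\<in>?T. pmf ?R t *\<^sub>R (1 - ?H t))"
      using T1 by (simp add: scaleR_diff_right sum_subtractf scaleR_sum_left[symmetric])
    also have "norm \<dots> \<le> (\<Sum>t\<in>?T. pmf ?R t * (2 * B * d))"
      using 2 by (intro sum_norm_le) (auto intro!: mult_left_mono)
    also have "\<dots> = 2 * B * d"
      using T1 by (simp add: sum_distrib_right[symmetric])
    finally show ?thesis .
  qed
  have "norm (Complex 1 (\<eta> * \<delta>) ^ m - 1) \<le> 4 * B * d"
    using norm_triangle_ineq4[of "Complex 1 (\<eta> * \<delta>) ^ m - (\<Prod>i<m. Complex 1 (\<eta> * bit_sign (v i) * \<alpha> i * \<gamma> i))"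
        "1 - (\<Prod>i<m. Complex 1 (\<eta> * bit_sign (v i) * \<alpha> i * \<gamma> i))"] 1 3
    by simp
  moreover have "real m * (\<eta> * \<delta>) = sqrt (real m) * \<delta>"
    using m by (simp add: \<eta>_def real_div_sqrt field_simps)
  then have "sqrt (real m) * \<delta> / 2 \<le> norm (Complex 1 (\<eta> * \<delta>) ^ m - 1)"
    using Im_power_Complex_ge(2)[of "\<eta> * \<delta>" m] \<delta> \<kappa> abs_Im_le_cmod[of "Complex 1 (\<eta> * \<delta>) ^ m - 1"]
    by (simp add: \<eta>_def)
  moreover have "B \<le> 2"
  proof (rule power2_le_imp_le)
    have "B\<^sup>2 = (1 + 1 / real m) ^ m"
      by (simp add: B_def \<eta>_def power_divide power_mult[symmetric] mult.commute[of m] power_mult)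
    also have "\<dots> \<le> exp (1 / real m) ^ m"
      by (intro power_mono) auto
    also have "\<dots> = exp 1" using m by (simp add: exp_of_nat_mult[symmetric])
    also have "\<dots> \<le> 3" by (rule exp_le)
    finally show "B\<^sup>2 \<le> 2\<^sup>2" by simp
  qed simp
  moreover have "0 \<le> d"
    using prob_diff_le_tv_dist[of P "{}" Q] by (simp add: d_def)
  then have "B * d \<le> 2 * d" using \<open>B \<le> 2\<close> by (intro mult_right_mono)
  ultimately have "sqrt (real m) * \<delta> / 16 \<le> d" by simp
  then show ?thesis
    using ab unfolding d_def Q_def \<beta>_def by simp
qed

section \<open>Choice of parameters and the query lower bound\<close>

theorem theorem3:
  fixes \<epsilon>\<^sub>1 :: real
  assumes "0 < \<epsilon>\<^sub>1" and "\<epsilon>\<^sub>1 < 1"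
  shows "\<exists>c > (0::real). \<exists>n\<^sub>0 :: nat. \<forall>n \<ge> n\<^sub>0. \<forall>\<epsilon> :: real. 0 < \<epsilon> \<and> \<epsilon> \<le> \<epsilon>\<^sub>1 \<longrightarrow>
           (\<forall>A q. eps_test n \<epsilon> (product_dists n) A \<and> makes_at_most n A q \<longrightarrow>
                  c * (sqrt (real n) / \<epsilon>\<^sup>2) \<le> real q)"
proof -
  \<comment> \<open>Chosen so that the large-distance bound
    \<open>1 - exp (- (K\<^sup>2 / 8))\<close> is the midpoint of \<open>\<epsilon>\<^sub>1\<close>
    and 1.\<close>
  define K where "K = sqrt (8 * ln (2 / (1 - \<epsilon>\<^sub>1)))"
  have ln_pos: "0 < ln (2 / (1 - \<epsilon>\<^sub>1))" using assms by (simp add: ln_gt_zero)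
  then have K: "0 < K" by (simp add: K_def)
  have "exp (- (K\<^sup>2 / 8)) = (1 - \<epsilon>\<^sub>1) / 2"
    using ln_pos assms by (simp add: K_def exp_minus)
  then have exp_K: "\<epsilon>\<^sub>1 < 1 - exp (- (K\<^sup>2 / 8))"
    using assms by (simp add: field_simps)
  \<comment> \<open>Makes \<open>\<kappa> \<le> C * \<epsilon>\<close> hold in both regimes:
    \<kappa> is \<open>20 * \<epsilon>\<close>, or it is \<open>K\<close> while \<epsilon> exceeds
    1/80.\<close>
  define C where "C = max 20 (80 * K)"
  have C: "20 \<le> C" "80 * K \<le> C" by (auto simp: C_def)
  \<comment> \<open>Large enough that the number of pairs exceeds \<open>K\<^sup>2\<close>, which
    keeps the bias \<delta> below 1.\<close>
  define n\<^sub>0 where "n\<^sub>0 = 2 * nat \<lceil>K\<^sup>2\<rceil> + 4"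
  show ?thesis
  proof (intro exI[of _ "1 / (8 * C\<^sup>2)"] conjI exI[of _ n\<^sub>0] allI impI)
    show "0 < 1 / (8 * C\<^sup>2)" using C by simp
    fix n \<epsilon> A q
    assume n: "n\<^sub>0 \<le> n" and \<epsilon>: "0 < \<epsilon> \<and> \<epsilon> \<le> \<epsilon>\<^sub>1"
      and A: "eps_test n \<epsilon> (product_dists n) A \<and> makes_at_most n A q"
    define m where "m = n div 2"
    have m: "0 < m" "2 * m \<le> n" "n \<le> 4 * m" "nat \<lceil>K\<^sup>2\<rceil> < m"
      using n by (auto simp: m_def n\<^sub>0_def)
    have mK: "K\<^sup>2 < real m"
      using m(4) by linarith
    \<comment> \<open>Up to 1/80 the value \<open>20 * \<epsilon>\<close> stays within the limit 1/4
      of the linear bound, and a sixteenth of it still exceeds \<epsilon>.\<close>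
    define \<kappa> where "\<kappa> = (if \<epsilon> \<le> 1 / 80 then 20 * \<epsilon> else K)"
    have \<kappa>: "0 < \<kappa>" "\<kappa> \<le> C * \<epsilon>"
    proof -
      show "0 < \<kappa>" using \<epsilon> K by (simp add: \<kappa>_def)
      have "20 * \<epsilon> \<le> C * \<epsilon>" using C \<epsilon> by (intro mult_right_mono) auto
      moreover have "K \<le> C * \<epsilon>" if "1 / 80 < \<epsilon>"
        using mult_mono[of "80 * K" C "1 / 80" \<epsilon>] C K that by simp
      ultimately show "\<kappa> \<le> C * \<epsilon>" by (auto simp: \<kappa>_def)
    qed
    define \<delta> where "\<delta> = \<kappa> / sqrt (real m)"
    have \<delta>_\<kappa>: "sqrt (real m) * \<delta> = \<kappa>" "real m * \<delta>\<^sup>2 = \<kappa>\<^sup>2"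
      using m(1) by (simp_all add: \<delta>_def power_divide)
    have "\<kappa> < sqrt (real m)"
    proof (cases "\<epsilon> \<le> 1 / 80")
      case True
      then have "\<kappa> < sqrt 1" by (simp add: \<kappa>_def)
      also have "\<dots> \<le> sqrt (real m)" using m(1) by (intro real_sqrt_le_mono) simp
      finally show ?thesis .
    next
      case False
      then show ?thesis using mK K by (simp add: \<kappa>_def real_less_rsqrt)
    qed
    then have \<delta>: "0 \<le> \<delta>" "\<delta> < 1"
      using \<kappa>(1) m(1) by (simp_all add: \<delta>_def)
    have far: "\<epsilon> < tv_dist (paired_dist m (\<lambda>i. \<delta> * bit_sign (v i))) \<nu>"
      if \<nu>: "\<nu> \<in> product_dists n" for v \<nu>
    proof (cases "\<epsilon> \<le> 1 / 80")
      case True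
      then have "sqrt (real m) * \<delta> \<le> 1 / 4" by (simp add: \<delta>_\<kappa> \<kappa>_def)
      then have "\<kappa> / 16 \<le> tv_dist (paired_dist m (\<lambda>i. \<delta> * bit_sign (v i))) \<nu>"
        using paired_dist_far_small[OF m(1) \<delta>(1) _ _ m(2) \<nu>, of v] \<delta>(2) by (simp add: \<delta>_\<kappa>)
      moreover have "\<epsilon> < \<kappa> / 16" using True \<epsilon> by (simp add: \<kappa>_def)
      ultimately show ?thesis by simp
    next
      case False
      then have "1 - exp (- (K\<^sup>2 / 8)) \<le> tv_dist (paired_dist m (\<lambda>i. \<delta> * bit_sign (v i))) \<nu>"
        using paired_dist_far_large[OF \<delta>(1) _ m(2) \<nu>, of v] \<delta>(2) by (simp add: \<delta>_\<kappa> \<kappa>_def)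
      then show ?thesis using exp_K \<epsilon> by simp
    qed
    have "1 / 10 \<le> real m * (real q * \<delta>\<^sup>2)\<^sup>2"
    proof (rule query_lower_bound[OF m(1) \<delta> m(2)])
      show "makes_at_most n A q" using A by simp
      show "2 / 3 \<le> measure_pmf.prob (run (paired_dist m (\<lambda>_. 0)) A) {(b, k). b}"
        using A paired_dist_in_cube_dists[OF m(2)] paired_dist_0_in_product_dists[OF m(2)]
        unfolding eps_test_def by blast
      show "2 / 3 \<le> measure_pmf.prob (run (paired_dist m (\<lambda>i. \<delta> * bit_sign (v i))) A) {(b, k). \<not> b}" for v
        using A paired_dist_in_cube_dists[OF m(2)] far
        unfolding eps_test_def by blast
    qed
    \<comment> \<open>As \<open>real m * \<delta>\<^sup>2\<close> equals
      \<open>\<kappa>\<^sup>2\<close>, one factor \<open>m\<close> is left in the denominator; its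
      root gives the dependence on \<open>sqrt n\<close>.\<close>
    also have "real m * (real q * \<delta>\<^sup>2)\<^sup>2 = (real q * \<kappa>\<^sup>2)\<^sup>2 / real m"
      using m(1) unfolding \<delta>_\<kappa>(2)[symmetric] by (simp add: power2_eq_square)
    finally have "real m \<le> 10 * (real q * \<kappa>\<^sup>2)\<^sup>2"
      using m(1) by (simp add: field_simps)
    also have "\<dots> \<le> (4 * (real q * \<kappa>\<^sup>2))\<^sup>2"
      by (simp add: power_mult_distrib)
    finally have "sqrt (real m) \<le> 4 * (real q * \<kappa>\<^sup>2)"
      by (intro real_le_lsqrt) auto
    moreover have "sqrt (real n) \<le> 2 * sqrt (real m)"
    proof -
      have "real n \<le> real (4 * m)" using m(3) by (simp only: of_nat_le_iff)
      then have "sqrt (real n) \<le> sqrt (4 * real m)" by simp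
      then show ?thesis by (simp add: real_sqrt_mult)
    qed
    moreover have "real q * \<kappa>\<^sup>2 \<le> real q * (C * \<epsilon>)\<^sup>2"
      using \<kappa> by (intro mult_left_mono power_mono) auto
    ultimately have "sqrt (real n) \<le> 8 * (real q * (C * \<epsilon>)\<^sup>2)" by linarith
    then have "sqrt (real n) \<le> real q * (8 * C\<^sup>2 * \<epsilon>\<^sup>2)"
      by (simp add: power_mult_distrib mult_ac)
    moreover have "0 < 8 * C\<^sup>2 * \<epsilon>\<^sup>2" using C \<epsilon> by simp
    ultimately have "sqrt (real n) / (8 * C\<^sup>2 * \<epsilon>\<^sup>2) \<le> real q"
      by (simp only: pos_divide_le_eq)
    then show "1 / (8 * C\<^sup>2) * (sqrt (real n) / \<epsilon>\<^sup>2) \<le> real q"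
      by simp
  qed
qed

end
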